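(* Let $G=AB$ be a finite group which is a weak normal product of subgroups $A$ and $B$, with $A$ normal in $G$. If the derived subgroup $G'$ is nilpotent and $A$ and $B$ are supersoluble, then $G$ is supersoluble.
   Context: All groups are finite. Two subgroups $X,Y$ of a group permute if $XY=YX$. Let $G=AB$ be a product of subgroups $A$ and $B$. $G$ is a weak normal product of $A$ and $B$ if (a) $A$ is normal in $G$, and (b) $B$ permutes with every maximal subgroup of every Sylow subgroup of $A$ (for all primes). *)

theory Defs
  imports "HOL-Algebra.Algebra"
begin

definition permutes_with :: "('a, 'b) monoid_scheme \<Rightarrow> 'a set \<Rightarrow> 'a set \<Rightarrow> bool" where
  "permutes_with G H K \<longleftrightarrow> H <#>\<^bsub>G\<^esub> K = K <#>\<^bsub>G\<^esub> H"

definition maximal_subgroup :: "'a set \<Rightarrow> ('a, 'b) monoid_scheme \<Rightarrow> bool" where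
  "maximal_subgroup M G \<longleftrightarrow>
     subgroup M G \<and> M \<noteq> carrier G \<and>
     (\<forall>K. subgroup K G \<and> M \<subseteq> K \<longrightarrow> K = M \<or> K = carrier G)"

text \<open>Only meaningful for finite \<open>G\<close>, since \<open>order G = 0\<close> for an infinite group. For a prime
  \<open>p\<close> not dividing \<open>order G\<close> the Sylow subgroup is trivial, so it has no maximal subgroups.\<close>

definition sylow_subgroup :: "nat \<Rightarrow> 'a set \<Rightarrow> ('a, 'b) monoid_scheme \<Rightarrow> bool" where
  "sylow_subgroup p P G \<longleftrightarrow>
     Factorial_Ring.prime p \<and> subgroup P G \<and> card P = p ^ multiplicity p (order G)"

definition weak_normal_product ::
    "('a, 'b) monoid_scheme \<Rightarrow> 'a set \<Rightarrow> 'a set \<Rightarrow> bool" where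
  "weak_normal_product G A B \<longleftrightarrow>
     subgroup A G \<and> subgroup B G \<and> carrier G = A <#>\<^bsub>G\<^esub> B \<and>
     A \<lhd> G \<and>
     (\<forall>p P M. sylow_subgroup p P (G\<lparr>carrier := A\<rparr>) \<and> maximal_subgroup M (G\<lparr>carrier := P\<rparr>)
        \<longrightarrow> permutes_with G B M)"

definition group_center :: "('a, 'b) monoid_scheme \<Rightarrow> 'a set" where
  "group_center G =
     {z \<in> carrier G. \<forall>g \<in> carrier G. z \<otimes>\<^bsub>G\<^esub> g = g \<otimes>\<^bsub>G\<^esub> z}"

text \<open>The terms of the series below are normal in the whole group, not merely in the next term.\<close>

definition normal_series :: "('a, 'b) monoid_scheme \<Rightarrow> (nat \<Rightarrow> 'a set) \<Rightarrow> nat \<Rightarrow> bool" where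
  "normal_series G N n \<longleftrightarrow>
     N 0 = {\<one>\<^bsub>G\<^esub>} \<and> N n = carrier G \<and>
     (\<forall>i\<le>n. N i \<lhd> G) \<and> (\<forall>i<n. N i \<subseteq> N (Suc i))"

definition nilpotent_group :: "('a, 'b) monoid_scheme \<Rightarrow> bool" where
  "nilpotent_group G \<longleftrightarrow>
     (\<exists>N n. normal_series G N n \<and>
        (\<forall>i<n. carrier ((G\<lparr>carrier := N (Suc i)\<rparr>) Mod N i) \<subseteq> group_center (G Mod N i)))"

definition supersoluble_group :: "('a, 'b) monoid_scheme \<Rightarrow> bool" where
  "supersoluble_group G \<longleftrightarrow>
     (\<exists>N n. normal_series G N n \<and>
        (\<forall>i<n. cyclic_group ((G\<lparr>carrier := N (Suc i)\<rparr>) Mod N i)))"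

end

theory Submission
  imports Defs "HOL-Number_Theory.Residue_Primitive_Roots"
begin

text \<open>
  Write \<open>D\<close> for the derived subgroup and \<open>N = A \<inter> D\<close>. A finite group is supersoluble as soon as
  every proper normal subgroup \<open>K\<close> misses some element \<open>x\<close> all of whose conjugates are powers of \<open>x\<close>
  modulo \<open>K\<close>, for such an \<open>x\<close> generates a normal cyclic subgroup modulo \<open>K\<close> and the required series
  can be continued past \<open>K\<close> (\<open>supersolubleI\<close>). If \<open>A \<subseteq> K\<close>, then \<open>G\<close> modulo \<open>K\<close> is an image of \<open>B\<close>, and the
  series of \<open>B\<close> supplies \<open>x\<close>. If \<open>N \<subseteq> K\<close> but not \<open>A \<subseteq> K\<close>, then every element of \<open>A\<close> is central modulo \<open>K\<close>,
  because commutators with elements of \<open>A\<close> lie in \<open>N\<close>.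

  There remains the case that \<open>N\<close> is not contained in \<open>K\<close>. The Sylow subgroups of \<open>N\<close> are normal in
  \<open>G\<close>, since \<open>D\<close> is nilpotent, and one of them, \<open>S\<close> say, for the prime \<open>p\<close>, is not contained in \<open>K\<close>. Let
  \<open>U\<close> be a minimal normal subgroup of \<open>G\<close> modulo \<open>K\<close> inside the image of \<open>S\<close>. Nilpotency makes \<open>D\<close> act
  trivially on \<open>U\<close>, so \<open>G\<close> acts on the elementary abelian group \<open>U\<close> irreducibly and through an
  abelian group. By the argument of Schur's lemma an element with one eigenvector in \<open>U\<close> acts on
  all of \<open>U\<close> as a fixed power map, and no element acts with order a nontrivial power of \<open>p\<close>
  (locale \<open>minimal_normal_p_subgroup\<close>). Elements of \<open>A\<close> have eigenvectors because \<open>A\<close> is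
  supersoluble. An element \<open>b\<close> of \<open>B\<close> has one as soon as its power \<open>b [^] (p - 1)\<close> acts trivially,
  because a linear map over the field of \<open>p\<close> elements whose \<open>(p - 1)\<close>-st power is the identity has
  an eigenvector (\<open>eigenvector_of_automorphism\<close>).

  It thus suffices that \<open>w [^] ((p - 1) * p ^ n)\<close> centralizes \<open>S\<close> for every \<open>w \<in> B\<close> whose order is a
  power of another prime; this is where permutability enters
  (\<open>weak_normal_product_sylow_action\<close>). Dividing by a suitable normal \<open>p'\<close>-subgroup of \<open>N\<close> makes a
  Sylow \<open>p\<close>-subgroup \<open>P\<close> of \<open>A\<close> normal. If \<open>M\<close> is a maximal subgroup of \<open>P\<close> containing \<open>B \<inter> P\<close>, then \<open>BM\<close> is
  a subgroup that meets the normal subgroup \<open>P\<close> in \<open>M\<close>, so \<open>B\<close> normalizes \<open>M\<close>. Hence \<open>w\<close> acts as a power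
  map on all these \<open>P / M\<close>, and also, \<open>B\<close> being supersoluble, on the factors of a series of \<open>B \<inter> P\<close>.
  The power of \<open>w\<close> in question acts trivially on all of them and has order prime to \<open>p\<close>, and a
  Frattini type argument with fixed points shows that it centralizes \<open>P\<close>
  (\<open>coprime_action_trivial\<close>).
\<close>

section \<open>Fixed points of p-groups and conjugation as a power map\<close>

text \<open>
  Every orbit has size a power of \<open>q\<close>; without a fixed point \<open>q\<close> would divide all of them.
\<close>

lemma p_group_action_fixed_point:
  fixes P (structure)
  assumes P: "group P" and card_P: "card (carrier P) = q ^ k" and q: "Factorial_Ring.prime q"
    and fin: "finite E" and ndvd: "\<not> q dvd card E"
    and closed: "\<And>g x. g \<in> carrier P \<Longrightarrow> x \<in> E \<Longrightarrow> \<phi> g x \<in> E"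
    and one: "\<And>x. x \<in> E \<Longrightarrow> \<phi> \<one> x = x"
    and mult: "\<And>g h x. g \<in> carrier P \<Longrightarrow> h \<in> carrier P \<Longrightarrow> x \<in> E \<Longrightarrow> \<phi> (g \<otimes> h) x = \<phi> g (\<phi> h x)"
  shows "\<exists>x\<in>E. \<forall>g\<in>carrier P. \<phi> g x = x"
proof (rule ccontr)
  assume no_fix: "\<not> ?thesis"
  interpret P: group P by (rule P)
  define \<psi> where "\<psi> g = restrict (\<phi> g) E" for g
  have bij: "bij_betw (\<phi> g) E E" if g: "g \<in> carrier P" for g
    by (rule bij_betw_byWitness[where f'="\<phi> (inv g)"])
      (use g in \<open>auto simp: closed mult[symmetric] one\<close>)
  have "\<psi> \<in> hom P (BijGroup E)"
  proof (rule homI)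
    show "\<psi> g \<in> carrier (BijGroup E)" if "g \<in> carrier P" for g
      using bij[OF that] unfolding \<psi>_def
      by (auto simp: BijGroup_def Bij_def bij_betw_restrict_eq)
    then show "\<psi> (g \<otimes> h) = \<psi> g \<otimes>\<^bsub>BijGroup E\<^esub> \<psi> h"
      if "g \<in> carrier P" "h \<in> carrier P" for g h
      using that by (auto simp: BijGroup_def \<psi>_def compose_def mult closed fun_eq_iff restrict_def)
  qed
  then interpret act: group_action P E \<psi>
    by (simp add: group_action_def group_hom_def group_hom_axioms_def P group_BijGroup)
  have orb: "q dvd card orb" if orb: "orb \<in> orbits P E \<psi>" for orb
  proof -
    obtain x where x: "x \<in> E" "orb = orbit P \<psi> x"
      using orb by (auto simp: orbits_def)
    have "card orb * card (stabilizer P \<psi> x) = q ^ k"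
      using act.orbit_stabilizer_theorem[OF x(1)] card_P by (simp add: x order_def)
    then have "card orb dvd q ^ k" by (metis dvd_triv_left)
    then obtain i where i: "card orb = q ^ i"
      using q by (auto simp: divides_primepow_nat)
    show ?thesis
    proof (cases i)
      case 0
      then have "card orb = 1" using i by simp
      moreover have "x \<in> orb" using act.orbit_refl x by blast
      ultimately have "orb = {x}" by (metis card_1_singletonE singletonD)
      then have "\<forall>g\<in>carrier P. \<phi> g x = x"
        using x by (auto simp: orbit_def \<psi>_def)
      then show ?thesis using no_fix x by blast
    qed (simp add: i)
  qed
  have "card E = (\<Sum>orb\<in>orbits P E \<psi>. card orb)"
    using act.disjoint_sum[OF fin, of "\<lambda>_. 1::nat"] by simp
  then have "q dvd card E" using orb by (simp add: dvd_sum)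
  then show False using ndvd by simp
qed

lemma (in group) finite_mult_closed_imp_subgroup:
  assumes fin: "finite (carrier G)" and sub: "S \<subseteq> carrier G" and one: "\<one> \<in> S"
    and mult: "\<And>x y. x \<in> S \<Longrightarrow> y \<in> S \<Longrightarrow> x \<otimes> y \<in> S"
  shows "subgroup S G"
proof (rule subgroupI)
  fix x assume x: "x \<in> S"
  then have xc: "x \<in> carrier G" using sub by blast
  have pow: "x [^] n \<in> S" for n :: nat by (induction n) (auto simp: one mult x)
  have "order G > 0" using fin by (simp add: order_gt_0_iff_finite)
  then obtain m where "order G = Suc m" by (cases "order G") auto
  then have "x [^] m \<otimes> x = \<one>"
    using pow_order_eq_1[OF xc] by simp
  then have "inv x = x [^] m" using xc by (metis inv_equality nat_pow_closed)
  then show "inv x \<in> S" using pow by simp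
qed (use sub one mult in auto)

lemma (in group) conj_by_pow_Suc:
  assumes "w \<in> carrier G" "x \<in> carrier G"
  shows "w [^] Suc j \<otimes> x \<otimes> inv (w [^] Suc j) = w \<otimes> (w [^] j \<otimes> x \<otimes> inv (w [^] j)) \<otimes> inv w"
proof -
  have "w [^] Suc j = w \<otimes> w [^] j" using assms by (metis nat_pow_Suc2)
  then show ?thesis using assms by (simp only: inv_mult_group nat_pow_closed m_assoc m_closed inv_closed)
qed

lemma (in group) conj_pow_of_conj_pow:
  assumes w: "w \<in> carrier G" and x: "x \<in> carrier G" and eq: "w \<otimes> x \<otimes> inv w = x [^] (a::nat)"
  shows "w [^] j \<otimes> x \<otimes> inv (w [^] (j::nat)) = x [^] (a ^ j)"
proof (induction j)
  case (Suc j)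
  have conj: "w \<otimes> x [^] n \<otimes> inv w = (x [^] a) [^] n" for n :: nat
  proof (induction n)
    case (Suc n)
    have "w \<otimes> x [^] Suc n \<otimes> inv w = (w \<otimes> x [^] n \<otimes> inv w) \<otimes> (w \<otimes> x \<otimes> inv w)"
      using w x by (simp add: m_assoc inv_solve_left)
    then show ?case using Suc eq x by simp
  qed (use w in simp)
  have "w [^] Suc j \<otimes> x \<otimes> inv (w [^] Suc j) = w \<otimes> (w [^] j \<otimes> x \<otimes> inv (w [^] j)) \<otimes> inv w"
    using w x by (rule conj_by_pow_Suc)
  also have "\<dots> = x [^] (a ^ Suc j)"
    using Suc conj x by (simp add: nat_pow_pow)
  finally show ?case .
qed (use x in simp)

text \<open>
  The cyclic group generated by \<open>z\<close> is a \<open>q\<close>-group acting on \<open>E\<close> by conjugation. This is used both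
  for elements of \<open>p\<close>-power order acting on the nonidentity elements of a \<open>p\<close>-group and for
  elements of \<open>p'\<close>-order acting on a coset of a \<open>p\<close>-group.
\<close>

lemma (in group) conj_fixed_point:
  assumes z: "z \<in> carrier G" and zq: "z [^] (q ^ k) = \<one>" and q: "Factorial_Ring.prime (q::nat)"
    and fin: "finite E" and sub: "E \<subseteq> carrier G" and ndvd: "\<not> q dvd card E"
    and inv_E: "\<And>x. x \<in> E \<Longrightarrow> z \<otimes> x \<otimes> inv z \<in> E"
  shows "\<exists>x\<in>E. z \<otimes> x = x \<otimes> z"
proof -
  have "ord z dvd q ^ k" using z zq pow_eq_id by auto
  then obtain i where i: "ord z = q ^ i" using q by (auto simp: divides_primepow_nat)
  then have "ord z \<noteq> 0" using q by (auto simp: prime_gt_0_nat)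
  then have gen: "generate G {z} = {z [^] j | j::nat. j \<in> UNIV}"
    using generate_pow_nat z by blast
  have conj_E: "z [^] j \<otimes> x \<otimes> inv (z [^] j) \<in> E" if "x \<in> E" for x and j :: nat
  proof (induction j)
    case (Suc j)
    have "z [^] Suc j \<otimes> x \<otimes> inv (z [^] Suc j) = z \<otimes> (z [^] j \<otimes> x \<otimes> inv (z [^] j)) \<otimes> inv z"
      using z that sub by (intro conj_by_pow_Suc) auto
    then show ?case using inv_E[OF Suc] by simp
  qed (use that sub in auto)
  let ?P = "G\<lparr>carrier := generate G {z}\<rparr>"
  have "\<exists>x\<in>E. \<forall>g\<in>carrier ?P. g \<otimes> x \<otimes> inv g = x"
  proof (rule p_group_action_fixed_point[where q = q and k = i])
    show "group ?P" using generate_is_subgroup z by (simp add: subgroup_imp_group)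
    show "card (carrier ?P) = q ^ i" using i generate_pow_card z by simp
    show "g \<otimes> x \<otimes> inv g \<in> E" if "g \<in> carrier ?P" "x \<in> E" for g x
      using that gen conj_E by auto
    show "\<one>\<^bsub>?P\<^esub> \<otimes> x \<otimes> inv \<one>\<^bsub>?P\<^esub> = x" if "x \<in> E" for x using that sub by auto
    show "(g \<otimes>\<^bsub>?P\<^esub> h) \<otimes> x \<otimes> inv (g \<otimes>\<^bsub>?P\<^esub> h) = g \<otimes> (h \<otimes> x \<otimes> inv h) \<otimes> inv g"
      if "g \<in> carrier ?P" "h \<in> carrier ?P" "x \<in> E" for g h x
    proof -
      have "g \<in> carrier G" "h \<in> carrier G" "x \<in> carrier G"
        using that generate_incl z sub by auto
      then show ?thesis by (simp add: m_assoc inv_mult_group)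
    qed
  qed (use q fin ndvd in auto)
  then obtain x where x: "x \<in> E" "\<forall>g\<in>generate G {z}. g \<otimes> x \<otimes> inv g = x" by auto
  moreover have "z \<in> generate G {z}" by (simp add: generate.incl)
  ultimately have "z \<otimes> x \<otimes> inv z = x" by blast
  then show ?thesis using x(1) z sub by (metis inv_solve_right' m_closed subsetD)
qed

lemma (in normal) rcos_eq_iff:
  assumes "x \<in> carrier G" "y \<in> carrier G"
  shows "H #> x = H #> y \<longleftrightarrow> x \<in> H #> y"
  using assms by (metis is_group group.rcos_self group.repr_independence subgroup_axioms)

lemma (in normal) rcos_pow:
  assumes "x \<in> carrier G"
  shows "(H #> x) [^]\<^bsub>G Mod H\<^esub> (n::nat) = H #> x [^] n"
  using FactGroup_pow[OF assms, of n] by simp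

lemma (in normal) mem_rcos_pow_mult:
  assumes "x \<in> carrier G" "y \<in> H #> x [^] (a::nat)" "z \<in> H #> x [^] (b::nat)"
  shows "y \<otimes> z \<in> H #> x [^] (a + b)"
  using assms rcos_sum[of "x [^] a" "x [^] b"] 
  by (auto simp: nat_pow_mult set_mult_def)

lemma (in normal) rcos_pows_subgroup:
  assumes fin: "finite (carrier G)" and x: "x \<in> carrier G"
  shows "subgroup {y. \<exists>a::nat. y \<in> H #> x [^] a} G"
proof (rule finite_mult_closed_imp_subgroup[OF fin])
  show "{y. \<exists>a::nat. y \<in> H #> x [^] a} \<subseteq> carrier G"
    using x by (auto intro: elemrcos_carrier[OF is_group, rotated])
  show "\<one> \<in> {y. \<exists>a::nat. y \<in> H #> x [^] a}"
    by (auto intro!: exI[of _ 0] simp: subset)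
  show "y \<otimes> z \<in> {y. \<exists>a::nat. y \<in> H #> x [^] a}"
    if "y \<in> {y. \<exists>a::nat. y \<in> H #> x [^] a}" "z \<in> {y. \<exists>a::nat. y \<in> H #> x [^] a}" for y z
    using that mem_rcos_pow_mult[OF x] by blast
qed

lemma (in group) normalizing_elements_subgroup:
  assumes fin: "finite (carrier G)" and M: "subgroup M G"
  shows "subgroup {y \<in> carrier G. \<forall>m\<in>M. y \<otimes> m \<otimes> inv y \<in> M} G" (is "subgroup ?N G")
proof (rule finite_mult_closed_imp_subgroup[OF fin])
  have Mc: "M \<subseteq> carrier G" using M by (simp add: subgroup.subset)
  show "?N \<subseteq> carrier G" "\<one> \<in> ?N" using Mc by auto
  show "y \<otimes> z \<in> ?N" if "y \<in> ?N" "z \<in> ?N" for y z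
  proof -
    have "y \<otimes> z \<otimes> m \<otimes> inv (y \<otimes> z) = y \<otimes> (z \<otimes> m \<otimes> inv z) \<otimes> inv y" if "m \<in> M" for m
      using that \<open>y \<in> ?N\<close> \<open>z \<in> ?N\<close> Mc by (auto simp: m_assoc inv_mult_group)
    then show ?thesis using that by auto
  qed
qed

text \<open>
  Normalizers grow in \<open>p\<close>-groups: \<open>M\<close> permutes the cosets of \<open>M\<close> other than \<open>M\<close> itself, whose number
  is congruent to \<open>-1\<close> modulo \<open>p\<close>, and representatives of a fixed coset normalize \<open>M\<close>.
\<close>

lemma (in group) maximal_subgroup_of_p_group_normal:
  assumes card_G: "card (carrier G) = p ^ n" and p: "Factorial_Ring.prime (p::nat)"
    and max: "maximal_subgroup M G"
  shows "M \<lhd> G"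
proof -
  have M: "subgroup M G" and M_ne: "M \<noteq> carrier G" using max by (auto simp: maximal_subgroup_def)
  have fin: "finite (carrier G)" using card_G p by (metis card_ge_0_finite prime_gt_0_nat zero_less_power)
  have Mc: "M \<subseteq> carrier G" using M by (simp add: subgroup.subset)
  have finM: "finite M" using Mc fin finite_subset by blast
  \<comment> \<open>\<open>g \<in> M\<close> sends a right coset \<open>C\<close> to \<open>C #> inv g\<close>, which makes this a left action.\<close>
  define E where "E = rcosets M - {M}"
  let ?P = "G\<lparr>carrier := M\<rparr>"
  have lag: "card (rcosets M) * card M = p ^ n"
    using lagrange[OF M] card_G by (simp add: order_def)
  obtain i where i: "card M = p ^ i" using lag p by (metis divides_primepow_nat dvd_triv_right)
  obtain j where j: "card (rcosets M) = p ^ j" using lag p by (metis divides_primepow_nat dvd_triv_left)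
  have fin_cos: "finite (rcosets M)"
    using rcosets_subset_PowG[OF M] fin by (meson finite_Pow_iff finite_subset)
  have M_in: "M \<in> rcosets M" using M Mc by (metis subgroup.subgroup_in_rcosets is_group)
  have "j \<noteq> 0"
  proof
    assume "j = 0"
    then have "card M = card (carrier G)" using lag j card_G by simp
    then show False using M_ne Mc fin by (simp add: card_subset_eq)
  qed
  then have "p dvd card (rcosets M)" using j by simp
  moreover have "card (rcosets M) = card E + 1"
    using card_Suc_Diff1[OF fin_cos M_in] by (simp add: E_def)
  ultimately have ndvd: "\<not> p dvd card E"
    using p by (metis dvd_add_right_iff not_prime_unit)
  have E: "\<exists>x\<in>carrier G - M. C = M #> x" if "C \<in> E" for C
    using that M unfolding E_def RCOSETS_def by (auto simp: coset_join2)
  have "\<exists>C\<in>E. \<forall>g\<in>carrier ?P. C #> inv g = C"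
  proof (rule p_group_action_fixed_point[where q = p and k = i])
    show "group ?P" using M by (simp add: subgroup_imp_group)
    show "C #> inv g \<in> E" if "g \<in> carrier ?P" "C \<in> E" for g C
    proof -
      obtain x where x: "x \<in> carrier G" "x \<notin> M" "C = M #> x" using E \<open>C \<in> E\<close> by blast
      have g: "g \<in> M" "g \<in> carrier G" using that(1) Mc by auto
      have eq: "C #> inv g = M #> (x \<otimes> inv g)" using x g Mc by (simp add: coset_mult_assoc)
      have "x \<otimes> inv g \<notin> M"
      proof
        assume "x \<otimes> inv g \<in> M"
        then have "x \<otimes> inv g \<otimes> g \<in> M" using g(1) M by (simp add: subgroup.m_closed)
        then show False using x g by (simp add: m_assoc)
      qed
      then have "M #> (x \<otimes> inv g) \<noteq> M"
        using x g M by (metis coset_join1 inv_closed m_closed Mc)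
      then show ?thesis unfolding eq E_def using x g by (auto simp: RCOSETS_def)
    qed
    show "C #> inv \<one>\<^bsub>?P\<^esub> = C" if "C \<in> E" for C
      using E[OF that] Mc by (auto simp: coset_mult_assoc)
    show "C #> inv (g \<otimes>\<^bsub>?P\<^esub> h) = C #> inv h #> inv g"
      if "g \<in> carrier ?P" "h \<in> carrier ?P" "C \<in> E" for g h C
      using E[OF that(3)] that(1,2) Mc
      by (auto simp: coset_mult_assoc inv_mult_group m_assoc r_coset_subset_G subset_iff)
  qed (use i p fin_cos ndvd in \<open>auto simp: E_def\<close>)
  then obtain C where C: "C \<in> E" "\<And>g. g \<in> M \<Longrightarrow> C #> inv g = C" by auto
  obtain x where x: "x \<in> carrier G" "x \<notin> M" "C = M #> x" using E C(1) by blast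
  have xM: "x \<otimes> g \<otimes> inv x \<in> M" if g: "g \<in> M" for g
  proof -
    have gc: "g \<in> carrier G" using g Mc by blast
    have "C #> inv (inv g) = C" using C(2) g M by (simp add: subgroup.m_inv_closed)
    then have "M #> (x \<otimes> g) = M #> x" using x gc Mc by (simp add: coset_mult_assoc)
    then have "x \<otimes> g \<in> M #> x" using x gc M by (metis m_closed rcos_self)
    then obtain m where "m \<in> M" "x \<otimes> g = m \<otimes> x" by (auto simp: r_coset_def)
    then show ?thesis using x gc Mc by (auto simp: m_assoc)
  qed
  define N where "N = {y \<in> carrier G. \<forall>m\<in>M. y \<otimes> m \<otimes> inv y \<in> M}"
  have "subgroup N G" unfolding N_def using normalizing_elements_subgroup[OF fin M] .
  moreover have "M \<subseteq> N"
    using Mc M by (auto simp: N_def intro!: subgroup.m_closed subgroup.m_inv_closed)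
  moreover have "x \<in> N" using x xM by (simp add: N_def)
  ultimately have "N = carrier G" using max x by (auto simp: maximal_subgroup_def)
  then show ?thesis using M by (auto simp: normal_inv_iff N_def)
qed

lemma (in group) maximal_normal_subgroup_pows:
  assumes fin: "finite (carrier G)" and max: "maximal_subgroup M G" and M: "M \<lhd> G"
    and x: "x \<in> carrier G" "x \<notin> M" and y: "y \<in> carrier G"
  shows "\<exists>a::nat. y \<in> M #> x [^] a"
proof -
  let ?L = "{y. \<exists>a::nat. y \<in> M #> x [^] a}"
  have "subgroup ?L G" using normal.rcos_pows_subgroup[OF M fin x(1)] .
  moreover have "M \<subseteq> ?L"
    using M by (auto intro!: exI[of _ 0] simp: normal_imp_subgroup subgroup.subset)
  moreover have "x \<in> ?L"
    using x M by (auto intro!: exI[of _ 1] simp: normal_imp_subgroup rcos_self)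
  ultimately have "?L = carrier G" using max x unfolding maximal_subgroup_def by blast
  then show ?thesis using y by blast
qed

text \<open>
  If \<open>a\<close> is prime to \<open>p\<close>, this is Euler's theorem modulo \<open>p ^ n\<close>. If \<open>p\<close> divides \<open>a\<close>, then \<open>x\<close> is a power
  of itself with exponent divisible by \<open>p\<close>, so \<open>x\<close> is trivial. The exponent is taken slightly
  larger than the totient of \<open>p ^ n\<close> so that one formula covers \<open>n = 0\<close> as well.
\<close>

lemma (in group) p_element_conj_pow_commutes:
  assumes fin: "finite (carrier G)" and p: "Factorial_Ring.prime (p::nat)"
    and w: "w \<in> carrier G" and x: "x \<in> carrier G" and xp: "x [^] (p ^ n) = \<one>"
    and eq: "w \<otimes> x \<otimes> inv w = x [^] (a::nat)"
  shows "w [^] ((p - 1) * p ^ n) \<otimes> x \<otimes> inv (w [^] ((p - 1) * p ^ n)) = x"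
proof (cases "p dvd a")
  case True
  define N where "N = order G"
  have N: "N > 0" using fin by (simp add: N_def order_gt_0_iff_finite)
  have "x = x [^] (a ^ N)"
    using conj_pow_of_conj_pow[OF w x eq, of N] pow_order_eq_1[OF w] x by (simp add: N_def)
  then have "int (ord x) dvd int (a ^ N) - 1"
    by (metis int_pow_1 int_pow_eq int_pow_int dvd_diff_commute x)
  moreover have "ord x dvd p ^ n" using xp pow_eq_id[OF x] by simp
  moreover have "coprime (int p ^ n) (int (a ^ N) - 1)"
  proof -
    have pa: "int p dvd int (a ^ N)" using True N by (meson dvd_power dvd_trans of_nat_dvd_iff)
    have "\<not> int p dvd int (a ^ N) - 1"
    proof
      assume "int p dvd int (a ^ N) - 1"
      then have "int p dvd int (a ^ N) - (int (a ^ N) - 1)" using pa by (rule dvd_diff[rotated])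
      then have "int p dvd 1" by simp
      then show False using p by (simp add: prime_gt_1_nat)
    qed
    then have "coprime (int p) (int (a ^ N) - 1)" using p by (simp add: prime_imp_coprime)
    then show ?thesis by simp
  qed
  ultimately have "is_unit (int (ord x))"
    by (metis coprime_common_divisor of_nat_dvd_iff of_nat_power)
  then have "ord x = 1" by simp
  then show ?thesis using ord_eq_1 x w by auto
next
  case False
  have "coprime a (p ^ n)" using False p by (metis coprime_power_right_iff prime_imp_coprime coprime_commute)
  show ?thesis
  proof (cases "n = 0")
    case True
    then show ?thesis using xp x w by simp
  next
    case n: False
    have "totient (p ^ n) = p ^ (n - 1) * (p - 1)" using p n by (simp add: totient_prime_power)
    then have e: "(p - 1) * p ^ n = totient (p ^ n) * p"
      using n by (metis mult.assoc mult.commute power_minus_mult gr0I)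
    have "[a ^ ((p - 1) * p ^ n) = 1] (mod p ^ n)"
      unfolding e power_mult using euler_theorem[OF \<open>coprime a (p ^ n)\<close>] cong_pow by fastforce
    moreover have "ord x dvd p ^ n" using xp pow_eq_id[OF x] by simp
    ultimately have "[a ^ ((p - 1) * p ^ n) = 1] (mod ord x)"
      by (rule cong_dvd_modulus_nat)
    then have "int (ord x) dvd int (a ^ ((p - 1) * p ^ n)) - int 1"
      by (simp add: cong_iff_dvd_diff flip: cong_int_iff)
    then have "x [^] (a ^ ((p - 1) * p ^ n)) = x"
      by (metis int_pow_1 int_pow_eq int_pow_int dvd_diff_commute of_nat_1 x)
    then show ?thesis using conj_pow_of_conj_pow[OF w x eq] by simp
  qed
qed

section \<open>Elements of order prime to p acting on a p-group\<close>

lemma (in group) conj_mult: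
  assumes "g \<in> carrier G" "x \<in> carrier G" "y \<in> carrier G"
  shows "g \<otimes> (x \<otimes> y) \<otimes> inv g = (g \<otimes> x \<otimes> inv g) \<otimes> (g \<otimes> y \<otimes> inv g)"
proof -
  have "inv g \<otimes> (g \<otimes> (y \<otimes> inv g)) = y \<otimes> inv g" using assms by (simp flip: m_assoc)
  then show ?thesis using assms by (simp add: m_assoc)
qed

text \<open>
  \<open>p_element_conj_pow_commutes\<close> in the quotient by \<open>H\<close>, pulled back to elements.
\<close>

lemma (in normal) p_element_conj_pow_rcos:
  assumes fin: "finite (carrier G)" and p: "Factorial_Ring.prime (p::nat)"
    and w: "w \<in> carrier G" and x: "x \<in> carrier G" and xp: "x [^] (p ^ n) \<in> H"
    and eq: "w \<otimes> x \<otimes> inv w \<in> H #> x [^] (a::nat)"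
  shows "w [^] ((p - 1) * p ^ n) \<otimes> x \<otimes> inv (w [^] ((p - 1) * p ^ n)) \<in> H #> x"
proof -
  let ?Q = "G Mod H" and ?f = "\<lambda>x. H #> x" and ?e = "(p - 1) * p ^ n"
  interpret Q: group ?Q by (rule factorgroup_is_group)
  interpret f: group_hom G ?Q ?f
    by (simp add: group_hom_def group_hom_axioms_def r_coset_hom_Mod)
  have finQ: "finite (carrier ?Q)" using fin by (simp add: carrier_FactGroup)
  have conj: "?f (u \<otimes> x \<otimes> inv u) = ?f u \<otimes>\<^bsub>?Q\<^esub> ?f x \<otimes>\<^bsub>?Q\<^esub> inv\<^bsub>?Q\<^esub> (?f u)" if "u \<in> carrier G" for u
    using that x by (simp only: f.hom_mult f.hom_inv m_closed inv_closed)
  have "?f (w \<otimes> x \<otimes> inv w) = ?f (x [^] a)" using eq w x by (intro rcos_eq_iff[THEN iffD2]) auto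
  then have 1: "?f w \<otimes>\<^bsub>?Q\<^esub> ?f x \<otimes>\<^bsub>?Q\<^esub> inv\<^bsub>?Q\<^esub> (?f w) = ?f x [^]\<^bsub>?Q\<^esub> a"
    using conj[OF w] rcos_pow[OF x] by (simp del: mult_FactGroup)
  have 2: "?f x [^]\<^bsub>?Q\<^esub> (p ^ n) = \<one>\<^bsub>?Q\<^esub>"
    using xp x by (simp add: rcos_pow rcos_const)
  have "?f (w [^] ?e \<otimes> x \<otimes> inv (w [^] ?e)) = ?f x"
    using Q.p_element_conj_pow_commutes[OF finQ p f.hom_closed[OF w] f.hom_closed[OF x] 2 1]
    using conj[of "w [^] ?e"] rcos_pow[OF w, of ?e] w by (simp del: mult_FactGroup)
  then show ?thesis using w x by (subst (asm) rcos_eq_iff) auto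
qed

text \<open>
  If the commutator \<open>d\<close> of \<open>h\<close> and \<open>x\<close> is centralized by \<open>h\<close>, then commutators with powers of \<open>h\<close> are
  the corresponding powers of \<open>d\<close>. Orders of \<open>h\<close> therefore bound orders of commutators, which is
  how coprimality of orders is turned into commutation below.
\<close>

lemma (in group) conj_pow_left:
  assumes "h \<in> carrier G" "x \<in> carrier G" "d \<in> carrier G"
    and "h \<otimes> x \<otimes> inv h = d \<otimes> x" and comm: "h \<otimes> d = d \<otimes> h"
  shows "h [^] j \<otimes> x \<otimes> inv (h [^] (j::nat)) = d [^] j \<otimes> x"
proof (induction j)
  case (Suc j)
  have hd: "h \<otimes> d [^] j = d [^] j \<otimes> h"
    using group_commutes_pow[OF comm[symmetric], of j] assms by simp
  have "h [^] Suc j \<otimes> x \<otimes> inv (h [^] Suc j) = h \<otimes> (d [^] j \<otimes> x) \<otimes> inv h"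
    using conj_by_pow_Suc assms(1,2) Suc by simp
  also have "\<dots> = (h \<otimes> d [^] j) \<otimes> x \<otimes> inv h" using assms(1-3) by (simp add: m_assoc)
  also have "\<dots> = d [^] j \<otimes> (h \<otimes> x \<otimes> inv h)" unfolding hd using assms(1-3) by (simp add: m_assoc)
  also have "\<dots> = d [^] Suc j \<otimes> x" using assms by (simp add: m_assoc)
  finally show ?case .
qed (use assms in simp)

lemma (in group) coprime_pows_eq_one:
  assumes "x \<in> carrier G" "x [^] (m::nat) = \<one>" "x [^] (n::nat) = \<one>" "coprime m n"
  shows "x = \<one>"
  using assms pow_eq_id ord_eq_1 by (metis coprime_common_divisor nat_dvd_1_iff_1)

lemma (in group) subgroup_pow_card:
  assumes "subgroup S G" "x \<in> S"
  shows "x [^] card S = \<one>"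
proof -
  interpret S: group "G\<lparr>carrier := S\<rparr>" using assms(1) by (rule subgroup_imp_group)
  show ?thesis using S.pow_order_eq_1[of x] assms(2) by (simp add: order_def flip: nat_pow_consistent)
qed

lemma (in group) proper_subgroup_below_maximal:
  assumes fin: "finite (carrier G)" and C: "subgroup C G" "C \<noteq> carrier G"
  obtains M where "maximal_subgroup M G" "C \<subseteq> M"
proof -
  define F where "F = {M. subgroup M G \<and> C \<subseteq> M \<and> M \<noteq> carrier G}"
  have "F \<subseteq> Pow (carrier G)" by (auto simp: F_def dest: subgroup.subset)
  then have "finite F" using fin by (meson finite_Pow_iff finite_subset)
  moreover have "C \<in> F" using C by (simp add: F_def)
  ultimately obtain M where M: "M \<in> F" "C \<subseteq> M" and max: "\<forall>K\<in>F. M \<subseteq> K \<longrightarrow> M = K"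
    by (metis finite_has_maximal2)
  have "maximal_subgroup M G" unfolding maximal_subgroup_def
    using M max by (auto simp: F_def)
  then show ?thesis using that M by blast
qed

text \<open>
  The element \<open>h = w [^] ((p - 1) * p ^ n)\<close> acts trivially on every section of \<open>P\<close> on which \<open>w\<close> acts
  as a power map. Because its order is prime to \<open>p\<close>, it centralizes \<open>B \<inter> P\<close>, by induction along
  the series \<open>D\<close>. If its centralizer \<open>C\<close> in \<open>P\<close> were proper, it would lie in a maximal subgroup \<open>M\<close>;
  as \<open>M\<close> contains \<open>B \<inter> P\<close>, it is invariant under \<open>w\<close>, so \<open>h\<close> acts trivially on \<open>P / M\<close>, and then \<open>h\<close> has a
  fixed point in a coset of \<open>M\<close> disjoint from \<open>C\<close>. Thus the quotients by maximal subgroups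
  above \<open>B \<inter> P\<close> take the place of the Frattini quotient in Burnside's theorem on coprime
  automorphisms.
\<close>

lemma (in group) coprime_action_trivial:
  fixes p r k n l :: nat
  assumes fin: "finite (carrier G)" and p: "Factorial_Ring.prime p" and r: "Factorial_Ring.prime r" "r \<noteq> p"
    and P: "P \<lhd> G" "card P = p ^ n" and B: "subgroup B G"
    and w: "w \<in> B" "w [^] (r ^ k) = \<one>"
    and max_inv: "\<And>M m. maximal_subgroup M (G\<lparr>carrier := P\<rparr>) \<Longrightarrow> B \<inter> P \<subseteq> M \<Longrightarrow> m \<in> M \<Longrightarrow> w \<otimes> m \<otimes> inv w \<in> M"
    and D0: "D 0 = {\<one>}" and Dl: "B \<inter> P \<subseteq> D l"
    and D_normal: "\<And>i. i \<le> l \<Longrightarrow> D i \<lhd> G\<lparr>carrier := B\<rparr>" and D_P: "\<And>i. i \<le> l \<Longrightarrow> D i \<subseteq> P"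
    and D_pow: "\<And>i x. i < l \<Longrightarrow> x \<in> D (Suc i) \<Longrightarrow> \<exists>a::nat. w \<otimes> x \<otimes> inv w \<in> D i #> x [^] a"
    and x: "x \<in> P"
  shows "w [^] ((p - 1) * p ^ n) \<otimes> x = x \<otimes> w [^] ((p - 1) * p ^ n)"
proof -
  define h where "h = w [^] ((p - 1) * p ^ n)"
  have Bc: "B \<subseteq> carrier G" using B by (simp add: subgroup.subset)
  have Psub: "subgroup P G" using P(1) by (rule normal_imp_subgroup)
  have Pc: "P \<subseteq> carrier G" using Psub by (simp add: subgroup.subset)
  have wc: "w \<in> carrier G" using w Bc by blast
  have hc: "h \<in> carrier G" using wc by (simp add: h_def)
  interpret Bg: group "G\<lparr>carrier := B\<rparr>" using B by (rule subgroup_imp_group)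
  have pows_B: "y [^] j \<in> B" if "y \<in> B" for y and j :: nat
    using Bg.nat_pow_closed[of y j] that by (simp flip: nat_pow_consistent)
  have hB: "h \<in> B" using pows_B[OF w(1)] by (simp add: h_def)
  have hr: "h [^] (r ^ k) = \<one>"
    using w(2) wc by (simp add: h_def nat_pow_pow) (metis mult.commute nat_pow_one nat_pow_pow)
  have cop: "coprime (r ^ k) (p ^ n)"
    using p r by (simp add: primes_coprime)
  have P_pow: "y [^] (p ^ n) = \<one>" if "y \<in> P" for y
    using subgroup_pow_card[OF Psub that] P(2) by simp
  \<comment> \<open>The commutator \<open>d\<close> of \<open>h\<close> with an element of \<open>D (Suc i)\<close> lies in \<open>D i\<close>, so \<open>h\<close> commutes with \<open>d\<close>,
      and the order of \<open>d\<close> divides both \<open>r ^ k\<close> and \<open>p ^ n\<close>.\<close>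
  have D_comm: "i \<le> l \<Longrightarrow> y \<in> D i \<Longrightarrow> h \<otimes> y = y \<otimes> h" for i y
  proof (induction i arbitrary: y)
    case 0
    then show ?case using D0 hc by simp
  next
    case (Suc i)
    have Di: "D i \<lhd> G\<lparr>carrier := B\<rparr>" using D_normal Suc.prems by simp
    have Di': "subgroup (D i) (G\<lparr>carrier := B\<rparr>)" using Di by (rule normal_imp_subgroup)
    have yP: "y \<in> P" using D_P Suc.prems by blast
    have yB: "y \<in> B" using normal_imp_subgroup[OF D_normal[OF Suc.prems(1)]] Suc.prems(2)
      by (force dest: subgroup.subset)
    obtain a :: nat where "w \<otimes> y \<otimes> inv w \<in> D i #> y [^] a"
      using D_pow Suc.prems by (meson Suc_le_lessD)
    then have "h \<otimes> y \<otimes> inv h \<in> D i #> y"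
      using normal.p_element_conj_pow_rcos[OF Di, of p w y n a] w(1) yB P_pow[OF yP] p B fin Bc
        Di' subgroup.one_closed[OF Di'] pows_B[OF w(1)]
      by (auto simp: h_def finite_subset simp flip: nat_pow_consistent)
    then obtain d where d: "d \<in> D i" "h \<otimes> y \<otimes> inv h = d \<otimes> y" by (auto simp: r_coset_def)
    have dP: "d \<in> P" using D_P d Suc.prems by (meson Suc_leD subsetD)
    have hd: "h \<otimes> d = d \<otimes> h" using Suc.IH d Suc.prems by simp
    have "h [^] (r ^ k) \<otimes> y \<otimes> inv (h [^] (r ^ k)) = d [^] (r ^ k) \<otimes> y"
      using conj_pow_left[OF hc _ _ d(2) hd] yP dP Pc by blast
    then have "d [^] (r ^ k) = \<one>" using hr yP dP Pc by (auto simp: subset_iff)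
    then have "d = \<one>" using coprime_pows_eq_one[OF _ _ P_pow[OF dP] cop] dP Pc by blast
    then show ?case using d(2) yP Pc hc by (metis inv_solve_right' l_one m_closed subsetD)
  qed
  define C where "C = {y \<in> P. h \<otimes> y = y \<otimes> h}"
  let ?P = "G\<lparr>carrier := P\<rparr>"
  interpret Pg: group ?P using Psub by (rule subgroup_imp_group)
  have finP: "finite (carrier ?P)" using Pc fin by (simp add: finite_subset)
  have C: "subgroup C ?P"
  proof (rule Pg.finite_mult_closed_imp_subgroup[OF finP])
    show "y \<otimes>\<^bsub>?P\<^esub> z \<in> C" if "y \<in> C" "z \<in> C" for y z
    proof -
      have c: "y \<in> carrier G" "z \<in> carrier G" "y \<otimes> z \<in> P"
        using that Pc Psub by (auto simp: C_def subgroup.m_closed)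
      have hy: "h \<otimes> y = y \<otimes> h" and hz: "h \<otimes> z = z \<otimes> h" using that by (auto simp: C_def)
      have "h \<otimes> (y \<otimes> z) = y \<otimes> (h \<otimes> z)" using c hc hy by (simp flip: m_assoc)
      also have "\<dots> = y \<otimes> z \<otimes> h" using c hc hz by (simp add: m_assoc)
      finally show ?thesis using c by (simp add: C_def)
    qed
  qed (use hc Psub in \<open>auto simp: C_def subgroup.one_closed\<close>)
  have "C = P"
  proof (rule ccontr)
    assume "C \<noteq> P"
    then obtain M where M: "maximal_subgroup M ?P" "C \<subseteq> M"
      using Pg.proper_subgroup_below_maximal[OF finP C] by auto
    have M_norm: "M \<lhd> ?P"
      using Pg.maximal_subgroup_of_p_group_normal[OF _ p M(1)] P(2) by simp
    have MP: "subgroup M ?P" "M \<noteq> P" using M(1) by (simp_all add: maximal_subgroup_def)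
    have MP_le: "M \<subseteq> P" using subgroup.subset[OF MP(1)] by simp
    have Msub: "subgroup M G" using incl_subgroup[OF Psub MP(1)] .
    then obtain x where x: "x \<in> P" "x \<notin> M" using MP MP_le by blast
    have BM: "B \<inter> P \<subseteq> M" using M(2) D_comm[of l] Dl by (auto simp: C_def)
    \<comment> \<open>Working inside the normalizer \<open>N\<close> of \<open>M\<close> makes \<open>M\<close> a normal subgroup, so that the action on
        \<open>P / M\<close> is defined.\<close>
    define N where "N = {g \<in> carrier G. \<forall>m\<in>M. g \<otimes> m \<otimes> inv g \<in> M}"
    have N: "subgroup N G" unfolding N_def by (rule normalizing_elements_subgroup[OF fin Msub])
    interpret Ng: group "G\<lparr>carrier := N\<rparr>" using N by (rule subgroup_imp_group)
    have wN: "w \<in> N" using max_inv[OF M(1) BM] wc by (simp add: N_def)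
    have PN: "P \<subseteq> N"
    proof
      fix g assume g: "g \<in> P"
      then have "g \<otimes>\<^bsub>?P\<^esub> m \<otimes>\<^bsub>?P\<^esub> inv\<^bsub>?P\<^esub> g \<in> M" if "m \<in> M" for m
        using M_norm that unfolding Pg.normal_inv_iff by auto
      then show "g \<in> N" using g Pc Psub by (auto simp: N_def)
    qed
    have MN: "M \<lhd> G\<lparr>carrier := N\<rparr>"
    proof (rule Ng.normal_inv_iff[THEN iffD2], intro conjI ballI)
      show "subgroup M (G\<lparr>carrier := N\<rparr>)" using subgroup_incl[OF Msub N] MP_le PN by blast
    qed (use N in \<open>auto simp: N_def\<close>)
    have "w \<otimes> x \<otimes> inv w \<in> P" using P(1) wc x by (auto simp: normal_inv_iff)
    then obtain a :: nat where a: "w \<otimes> x \<otimes> inv w \<in> M #> x [^] a"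
      using Pg.maximal_normal_subgroup_pows[OF finP M(1) M_norm, of x] x Psub
      by (auto simp flip: nat_pow_consistent)
    have hx: "h \<otimes> x \<otimes> inv h \<in> M #> x"
    proof -
      have "w [^] ((p - 1) * p ^ n) \<in> N" 
        using Ng.nat_pow_closed[of w] wN by (simp flip: nat_pow_consistent)
      then show ?thesis
        using normal.p_element_conj_pow_rcos[OF MN, of p w x n a] wN x PN P_pow[OF x(1)] p N fin a
          subgroup.one_closed[OF Msub] subgroup.subset[OF N]
        by (auto simp: h_def finite_subset simp flip: nat_pow_consistent)
    qed
    have hN: "h \<in> N" 
      using Ng.nat_pow_closed[of w] wN by (simp add: h_def flip: nat_pow_consistent)
    have xc: "x \<in> carrier G" and Mc: "M \<subseteq> carrier G" using x Pc MP_le by auto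
    have "card M dvd p ^ n"
      using dvd_triv_right[of "card M" "card (rcosets\<^bsub>?P\<^esub> M)"] Pg.lagrange[OF MP(1)] P(2)
      by (simp add: order_def)
    then obtain i where i: "card M = p ^ i" using p by (auto simp: divides_primepow_nat)
    \<comment> \<open>The coset is invariant under \<open>h\<close>, its size is a power of \<open>p\<close>, and \<open>h\<close> has \<open>r\<close>-power order.\<close>
    have "\<exists>y\<in>M #> x. h \<otimes> y = y \<otimes> h"
    proof (rule conj_fixed_point[OF hc hr r(1)])
      show "M #> x \<subseteq> carrier G" using xc Mc by (rule r_coset_subset_G[rotated])
      then show "finite (M #> x)" using fin finite_subset by blast
      have "M #> x \<in> rcosets M" using xc Mc by (simp add: rcosetsI)
      then obtain f where "bij_betw f M (M #> x)" using card_cosets_equal Mc by blast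
      then have "card (M #> x) = p ^ i" using i by (simp add: bij_betw_same_card)
      then show "\<not> r dvd card (M #> x)"
        using p r by (metis prime_dvd_power primes_dvd_imp_eq)
      show "h \<otimes> y \<otimes> inv h \<in> M #> x" if y: "y \<in> M #> x" for y
      proof -
        obtain m where m: "m \<in> M" "y = m \<otimes> x" using y by (auto simp: r_coset_def)
        obtain m' where m': "m' \<in> M" "h \<otimes> x \<otimes> inv h = m' \<otimes> x" using hx by (auto simp: r_coset_def)
        have mc: "m \<in> carrier G" "m' \<in> carrier G" using m m' Mc by auto
        have "h \<otimes> y \<otimes> inv h = (h \<otimes> m \<otimes> inv h) \<otimes> (h \<otimes> x \<otimes> inv h)"
          using conj_mult[of h m x] m mc xc hc by simp
        also have "\<dots> = ((h \<otimes> m \<otimes> inv h) \<otimes> m') \<otimes> x" using m' mc xc hc by (simp add: m_assoc)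
        finally have "h \<otimes> y \<otimes> inv h = ((h \<otimes> m \<otimes> inv h) \<otimes> m') \<otimes> x" .
        moreover have "(h \<otimes> m \<otimes> inv h) \<otimes> m' \<in> M"
          using subgroup.m_closed[OF Msub _ m'(1)] m(1) hN by (simp add: N_def)
        ultimately show ?thesis by (auto simp: r_coset_def)
      qed
    qed
    then obtain m where m: "m \<in> M" "h \<otimes> (m \<otimes> x) = (m \<otimes> x) \<otimes> h" by (auto simp: r_coset_def)
    then have "m \<otimes> x \<in> C" using MP_le x Psub by (auto simp: C_def intro!: subgroup.m_closed)
    then have "inv m \<otimes> (m \<otimes> x) \<in> M" using M(2) m Msub by (meson subgroup.m_closed subgroup.m_inv_closed subsetD)
    then show False using x m xc Mc by (auto simp: m_assoc[symmetric])
  qed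
  then have "x \<in> C" using x by simp
  then show ?thesis by (simp add: C_def h_def)
qed

section \<open>Eigenvectors over the prime field\<close>

text \<open>
  Summing over the powers of a primitive root \<open>g\<close> turns this into a geometric series with ratio
  \<open>g ^ j\<close>, which is not \<open>1\<close> modulo \<open>p\<close>.
\<close>

lemma prime_dvd_power_sum:
  fixes p j :: nat
  assumes p: "Factorial_Ring.prime p" and j: "0 < j" "j < p - 1"
  shows "p dvd (\<Sum>a\<in>{1..<p}. a ^ j)"
proof -
  obtain g where g: "residue_primroot p g"
    using prime_primitive_root_exists[OF _ p] p prime_gt_1_nat by blast
  have tot: "totient p = p - 1" using p by (simp add: totient_prime)
  have cop: "coprime p g" and ordg: "Pocklington.ord p g = p - 1"
    using g tot by (auto simp: residue_primroot_def)
  have "bij_betw (\<lambda>i. g ^ i mod p) {..<p - 1} {1..<p}"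
    using residue_primroot_is_generator[OF _ g] p prime_gt_1_nat[OF p] tot
    by (simp add: totatives_prime atLeastSucLessThan_greaterThanLessThan)
  then have "(\<Sum>a\<in>{1..<p}. a ^ j) = (\<Sum>i<p - 1. (g ^ i mod p) ^ j)"
    by (rule sum.reindex_bij_betw[symmetric])
  also have "[\<dots> = (\<Sum>i<p - 1. (g ^ j) ^ i)] (mod p)"
  proof (rule cong_sum)
    fix i
    have "[(g ^ i mod p) ^ j = (g ^ i) ^ j] (mod p)" by (intro cong_pow) (simp add: cong_def)
    then show "[(g ^ i mod p) ^ j = (g ^ j) ^ i] (mod p)"
      by (simp add: mult.commute flip: power_mult)
  qed
  finally have S: "[(\<Sum>a\<in>{1..<p}. a ^ j) = (\<Sum>i<p - 1. (g ^ j) ^ i)] (mod p)" .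
  have "\<not> int p dvd int (g ^ j) - 1"
  proof
    assume "int p dvd int (g ^ j) - 1"
    then have "[int (g ^ j) = int 1] (mod int p)" by (simp add: cong_iff_dvd_diff)
    then have "[g ^ j = 1] (mod p)" by (simp only: cong_int_iff)
    then have "p - 1 dvd j" using ordg ord_divides by metis
    then show False using j by (auto dest: dvd_imp_le)
  qed
  moreover have "int p dvd (int (g ^ j) - 1) * (\<Sum>i<p - 1. int (g ^ j) ^ i)"
  proof -
    have "[(g ^ j) ^ (p - 1) = 1] (mod p)"
      using euler_theorem[of "g ^ j" p] cop tot by (simp add: coprime_commute)
    then have "[int ((g ^ j) ^ (p - 1)) = int 1] (mod int p)" by (simp only: cong_int_iff)
    then show ?thesis by (simp add: cong_iff_dvd_diff power_diff_1_eq[symmetric])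
  qed
  ultimately have "int p dvd (\<Sum>i<p - 1. int (g ^ j) ^ i)"
    using p prime_dvd_mult_iff[of "int p"] by simp
  then have "int p dvd int (\<Sum>i<p - 1. (g ^ j) ^ i)" by simp
  then have "p dvd (\<Sum>i<p - 1. (g ^ j) ^ i)" by (simp only: int_dvd_int_iff)
  then show ?thesis using S cong_dvd_iff by blast
qed

lemma prime_power_sum_fermat:
  fixes p :: nat
  assumes p: "Factorial_Ring.prime p"
  shows "[(\<Sum>a\<in>{1..<p}. a ^ (p - 1)) = p - 1] (mod p)"
proof -
  have "[(\<Sum>a\<in>{1..<p}. a ^ (p - 1)) = (\<Sum>a\<in>{1..<p}. 1)] (mod p)"
  proof (rule cong_sum)
    fix a assume "a \<in> {1..<p}"
    then show "[a ^ (p - 1) = 1] (mod p)" using p by (intro fermat_theorem) (auto dest: dvd_imp_le)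
  qed
  then show ?thesis by simp
qed

lemma (in group) pow_eq_if_cong:
  assumes "x \<in> carrier G" "x [^] (p::nat) = \<one>" "[m = n] (mod p)"
  shows "x [^] m = x [^] (n::nat)"
proof -
  have "ord x dvd p" using assms pow_eq_id by simp
  then have "[m = n] (mod ord x)" using assms(3) cong_dvd_modulus_nat by blast
  then have "[int n = int m] (mod int (ord x))" by (simp add: cong_int_iff cong_sym)
  then show ?thesis using assms(1)
    by (metis cong_iff_dvd_diff int_pow_eq int_pow_int)
qed

text \<open>
  Over the field of \<open>p\<close> elements the polynomial \<open>X ^ (p - 1) - 1\<close> splits into distinct linear
  factors, so \<open>\<sigma>\<close> is diagonalizable. Concretely, the element \<open>w a\<close> of the proof is, up to a
  scalar, the projection of \<open>v\<close> to the eigenspace of \<open>a\<close>, and these projections cannot all vanish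
  because they add up to a nonzero multiple of \<open>v\<close>.
\<close>

lemma (in comm_group) eigenvector_of_automorphism:
  fixes p :: nat
  assumes p: "Factorial_Ring.prime p" and \<sigma>: "\<sigma> \<in> hom G G"
    and exp_p: "\<And>x. x \<in> carrier G \<Longrightarrow> x [^] p = \<one>"
    and \<sigma>_pow: "\<And>x. x \<in> carrier G \<Longrightarrow> (\<sigma> ^^ (p - 1)) x = x"
    and v: "v \<in> carrier G" "v \<noteq> \<one>"
  shows "\<exists>u\<in>carrier G. u \<noteq> \<one> \<and> (\<exists>a::nat. \<sigma> u = u [^] a)"
proof (rule ccontr)
  assume no: "\<not> ?thesis"
  obtain m where m: "p = m + 2" using prime_ge_2_nat[OF p] by (metis add.commute le_Suc_ex)
  interpret \<sigma>: group_hom G G \<sigma> using \<sigma> by (simp add: group_hom_def group_hom_axioms_def)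
  have x: "(\<sigma> ^^ j) v \<in> carrier G" for j by (induction j) (auto simp: v)
  \<comment> \<open>In additive notation \<open>w a\<close> is the sum of \<open>a ^ (p - 1 - j)\<close> times \<open>(\<sigma> ^^ j) v\<close>; the coefficient
      stands for \<open>a ^ (- j)\<close>, and \<open>j\<close> runs up to \<open>m = p - 2\<close>.\<close>
  define w where "w a = (\<Otimes>j\<in>{..m}. (\<sigma> ^^ j) v [^] (a ^ (m + 1 - j)))" for a :: nat
  have w: "w a \<in> carrier G" for a unfolding w_def using x by (intro finprod_closed) auto
  have \<sigma>_prod: "\<sigma> (\<Otimes>j\<in>S. f j) = (\<Otimes>j\<in>S. \<sigma> (f j))" if "finite S" "f \<in> S \<rightarrow> carrier G" for f :: "nat \<Rightarrow> 'a" and S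
    using that by (induction S) (auto simp: Pi_iff)
  have pow_prod: "(\<Otimes>j\<in>S. f j) [^] n = (\<Otimes>j\<in>S. f j [^] n)" if "finite S" "f \<in> S \<rightarrow> carrier G"
    for f :: "nat \<Rightarrow> 'a" and S and n :: nat
    using that by (induction S) (auto simp: Pi_iff nat_pow_distrib)
  have eig: "\<sigma> (w a) = w a [^] a" for a
  proof -
    define F where "F j = (\<sigma> ^^ j) v [^] (a ^ (m + 2 - j))" for j
    have F: "F j \<in> carrier G" for j using x by (simp add: F_def)
    have "\<sigma> (w a) = (\<Otimes>j\<in>{..m}. F (Suc j))"
      unfolding w_def F_def using x by (subst \<sigma>_prod) (auto simp: \<sigma>.hom_nat_pow intro!: finprod_cong')
    moreover have "w a [^] a = (\<Otimes>j\<in>{..m}. F j)"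
      unfolding w_def F_def using x
      by (subst pow_prod) (auto simp: nat_pow_pow Suc_diff_le intro!: finprod_cong' simp flip: power_Suc2)
    \<comment> \<open>Both sides are the product of \<open>F 0, \<dots>, F (m + 1)\<close>; applying \<open>\<sigma>\<close> shifts the index by one.\<close>
    moreover have "(\<Otimes>j\<in>{..m}. F (Suc j)) \<otimes> F 0 = F (Suc m) \<otimes> (\<Otimes>j\<in>{..m}. F j)"
      using finprod_Suc[of F m] finprod_Suc2[of F m] F by simp
    moreover have "F 0 = F (Suc m)"
    proof -
      have "[a ^ p = a] (mod p)"
      proof (cases "p dvd a")
        case True
        then show ?thesis using m by (simp add: cong_def mod_eq_0_iff_dvd)
      next
        case False
        then have "[a * a ^ (p - 1) = a * 1] (mod p)"
          using p by (intro cong_scalar_left fermat_theorem)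
        then show ?thesis using m by simp
      qed
      then have "v [^] (a ^ p) = v [^] a" using pow_eq_if_cong exp_p v by blast
      then show ?thesis using \<sigma>_pow[OF v(1)] m by (simp add: F_def)
    qed
    ultimately show ?thesis using F by (simp add: m_comm)
  qed
  have w_one: "w a = \<one>" for a using no eig w by blast
  have all: "(\<Otimes>j\<in>{..m}. (\<sigma> ^^ j) v [^] (\<Sum>a\<in>S. a ^ (m + 1 - j))) = \<one>" if "finite S" for S :: "nat set"
    using that
  proof (induction S)
    case (insert b S)
    have "(\<Otimes>j\<in>{..m}. (\<sigma> ^^ j) v [^] (\<Sum>a\<in>insert b S. a ^ (m + 1 - j)))
        = w b \<otimes> (\<Otimes>j\<in>{..m}. (\<sigma> ^^ j) v [^] (\<Sum>a\<in>S. a ^ (m + 1 - j)))"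
      unfolding w_def using insert(1,2) x
      by (subst finprod_multf[symmetric]) (auto simp: nat_pow_mult intro!: finprod_cong')
    then show ?case using insert w_one by simp
  qed simp
  \<comment> \<open>In the sum over all nonzero residues \<open>a\<close>, the power sums annihilate every term except the
      one for \<open>j = 0\<close>.\<close>
  define E where "E j = (\<Sum>a\<in>{1..<p}. a ^ (m + 1 - j))" for j
  have "(\<Otimes>j\<in>{..m}. (\<sigma> ^^ j) v [^] E j) = v [^] E 0"
  proof -
    have "(\<sigma> ^^ j) v [^] E j = (if 0 = j then v [^] E 0 else \<one>)" if "j \<in> {..m}" for j
    proof (cases "j = 0")
      case False
      then have "p dvd E j" unfolding E_def using that m p by (intro prime_dvd_power_sum) auto
      then show ?thesis using False pow_eq_if_cong[OF x exp_p[OF x], of "E j" 0]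
        by (simp add: cong_0_iff)
    qed simp
    then have "(\<Otimes>j\<in>{..m}. (\<sigma> ^^ j) v [^] E j) = (\<Otimes>j\<in>{..m}. if 0 = j then v [^] E 0 else \<one>)"
      using v by (intro finprod_cong') auto
    also have "\<dots> = v [^] E 0"
      using finprod_singleton[of 0 "{..m}" "\<lambda>_. v [^] E 0"] v by simp
    finally show ?thesis .
  qed
  then have "v [^] E 0 = \<one>" using all[of "{1..<p}"] by (simp add: E_def)
  moreover have "v [^] E 0 = v [^] (p - 1)"
    using prime_power_sum_fermat[OF p] m v exp_p by (intro pow_eq_if_cong[where p = p]) (auto simp: E_def)
  ultimately have "v [^] (p - 1) = \<one>" by simp
  moreover have "v [^] p = v [^] (p - 1) \<otimes> v" using m by simp
  ultimately show False using exp_p[OF v(1)] v by simp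
qed

section \<open>Minimal normal p-subgroups with abelian action\<close>

lemma (in group) nat_pow_conj:
  assumes "g \<in> carrier G" "x \<in> carrier G"
  shows "(g \<otimes> x \<otimes> inv g) [^] (n::nat) = g \<otimes> x [^] n \<otimes> inv g"
  using assms by (induction n) (simp_all add: conj_mult[symmetric])

lemma (in group) conj_conj:
  assumes "g \<in> carrier G" "h \<in> carrier G" "x \<in> carrier G"
  shows "(g \<otimes> h) \<otimes> x \<otimes> inv (g \<otimes> h) = g \<otimes> (h \<otimes> x \<otimes> inv h) \<otimes> inv g"
  using assms by (simp add: m_assoc inv_mult_group)

lemma (in group) subgroup_int_pow_closed:
  assumes "subgroup C G" "z \<in> C"
  shows "z [^] (n::int) \<in> C"
proof -
  interpret C: group "G\<lparr>carrier := C\<rparr>" using assms(1) by (rule subgroup_imp_group)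
  show ?thesis using C.int_pow_closed[of z n] int_pow_consistent[OF assms] assms by simp
qed

lemma (in group) subgroup_nat_pow_closed:
  assumes "subgroup C G" "z \<in> C"
  shows "z [^] (n::nat) \<in> C"
  using subgroup_int_pow_closed[OF assms, of "int n"] by (simp add: int_pow_int)

lemma (in group) gcd_pow_in_subgroup:
  assumes C: "subgroup C G" and z: "z \<in> carrier G" and "z [^] (a::nat) \<in> C" "z [^] (b::nat) \<in> C"
  shows "z [^] gcd a b \<in> C"
proof -
  obtain u v where uv: "u * int a + v * int b = gcd (int a) (int b)" using bezout_int by blast
  have "z [^] (u * int a + v * int b) = (z [^] a) [^] u \<otimes> (z [^] b) [^] v"
    using z by (simp add: int_pow_mult int_pow_pow mult.commute flip: int_pow_int)
  then have "z [^] (int (gcd a b)) \<in> C"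
    using assms uv by (simp add: subgroup.m_closed subgroup_int_pow_closed)
  then show ?thesis by (simp add: int_pow_int)
qed

text \<open>
  The exponents \<open>s\<close> with \<open>z [^] s \<in> C\<close> are closed under greatest common divisors, and no prime
  divides all of them.
\<close>

lemma (in group) in_subgroup_if_pows_in_subgroup:
  assumes C: "subgroup C G" and z: "z \<in> carrier G" and fin: "finite (carrier G)"
    and pows: "\<And>r. Factorial_Ring.prime (r::nat) \<Longrightarrow> \<exists>s. \<not> r dvd s \<and> z [^] s \<in> C"
  shows "z \<in> C"
proof -
  define t :: nat where "t = (LEAST t. 0 < t \<and> z [^] t \<in> C)"
  have "z [^] order G \<in> C" using pow_order_eq_1[OF z] C by (simp add: subgroup.one_closed)
  then have ex: "0 < order G \<and> z [^] order G \<in> C" using fin order_gt_0_iff_finite by blast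
  have t: "0 < t" "z [^] t \<in> C" using LeastI[of "\<lambda>t. 0 < t \<and> z [^] t \<in> C", OF ex] by (auto simp: t_def)
  have "t = 1"
  proof (rule ccontr)
    assume "t \<noteq> 1"
    then obtain r where r: "Factorial_Ring.prime r" "r dvd t" using prime_factor_nat by blast
    obtain s where s: "\<not> r dvd s" "z [^] s \<in> C" using pows r by blast
    have "t \<le> gcd t s"
      using gcd_pow_in_subgroup[OF C z t(2) s(2)] t(1) unfolding t_def by (intro Least_le) auto
    then have "t dvd s" using t(1) by (metis gcd_dvd1 gcd_dvd2 dvd_imp_le le_antisym)
    then show False using r s dvd_trans by blast
  qed
  then show ?thesis using t z by simp
qed

text \<open>
  Take for \<open>s\<close> the part of the order of \<open>y\<close> prime to \<open>r\<close>. Together with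
  \<open>in_subgroup_if_pows_in_subgroup\<close> this replaces the decomposition of an element into its
  primary parts.
\<close>

lemma (in group) ord_prime_part:
  assumes "finite (carrier G)" "y \<in> carrier G" "Factorial_Ring.prime (r::nat)"
  obtains s k where "\<not> r dvd s" "(y [^] s) [^] (r ^ k) = \<one>"
proof -
  have "ord y \<noteq> 0" using ord_ge_1[OF assms(1,2)] by simp
  then obtain s where s: "ord y = r ^ multiplicity r (ord y) * s" "\<not> r dvd s"
    using multiplicity_decompose'[of "ord y" r] assms(3) not_prime_unit by metis
  have "(y [^] s) [^] (r ^ multiplicity r (ord y)) = y [^] ord y"
    using assms(2) s(1) by (simp add: nat_pow_pow mult.commute)
  then show ?thesis using that s assms by simp
qed

text \<open>
  A chief factor below the derived subgroup, viewed in the quotient where it has become a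
  minimal normal subgroup. The hypothesis \<open>abelian_action\<close> says that the image of \<open>G\<close> in the
  automorphism group of \<open>U\<close> is abelian, so that the centralizer or eigenspace in \<open>U\<close> of a single
  group element is already normal in \<open>G\<close>.
\<close>

locale minimal_normal_p_subgroup = group +
  fixes p m :: nat and U
  assumes fin: "finite (carrier G)" and p: "Factorial_Ring.prime p"
    and U: "U \<lhd> G" and card_U: "card U = p ^ m"
    and irred: "\<And>W. W \<lhd> G \<Longrightarrow> W \<subseteq> U \<Longrightarrow> W = {\<one>} \<or> W = U"
    and abelian_action: "\<And>g h u. g \<in> carrier G \<Longrightarrow> h \<in> carrier G \<Longrightarrow> u \<in> U \<Longrightarrow>
      g \<otimes> h \<otimes> u \<otimes> inv (g \<otimes> h) = h \<otimes> g \<otimes> u \<otimes> inv (h \<otimes> g)"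
    and U_comm: "\<And>u v. u \<in> U \<Longrightarrow> v \<in> U \<Longrightarrow> u \<otimes> v = v \<otimes> u"
begin

lemma U_sub: "subgroup U G"
  using U by (rule normal_imp_subgroup)

lemma U_carrier: "u \<in> U \<Longrightarrow> u \<in> carrier G"
  using U_sub by (rule subgroup.mem_carrier)

lemma U_conj: "g \<in> carrier G \<Longrightarrow> u \<in> U \<Longrightarrow> g \<otimes> u \<otimes> inv g \<in> U"
  using U by (simp add: normal_inv_iff)

lemma U_pow: "u \<in> U \<Longrightarrow> u [^] (n::nat) \<in> U"
  using U_sub by (rule subgroup_nat_pow_closed)

lemma U_mult: "u \<in> U \<Longrightarrow> v \<in> U \<Longrightarrow> u \<otimes> v \<in> U"
  using U_sub by (rule subgroup.m_closed)

lemma U_one: "\<one> \<in> U"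
  using U_sub by (rule subgroup.one_closed)

lemma normal_subsetI:
  assumes "W \<subseteq> U" "\<one> \<in> W" "\<And>u v. u \<in> W \<Longrightarrow> v \<in> W \<Longrightarrow> u \<otimes> v \<in> W"
    and "\<And>g u. g \<in> carrier G \<Longrightarrow> u \<in> W \<Longrightarrow> g \<otimes> u \<otimes> inv g \<in> W"
  shows "W \<lhd> G"
  unfolding normal_inv_iff using assms U_carrier
  by (auto intro!: finite_mult_closed_imp_subgroup[OF fin])

lemma U_pow_mult:
  assumes "u \<in> U" "v \<in> U"
  shows "(u \<otimes> v) [^] (n::nat) = u [^] n \<otimes> v [^] n"
  using pow_mult_distrib[OF U_comm[OF assms] U_carrier[OF assms(1)] U_carrier[OF assms(2)]] .

text \<open>
  The elements of order dividing \<open>p\<close> form a normal subgroup, which is nontrivial unless \<open>U\<close> is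
  trivial.
\<close>

lemma U_exp_p:
  assumes "u \<in> U"
  shows "u [^] p = \<one>"
proof -
  define W where "W = {u \<in> U. u [^] p = \<one>}"
  have "W \<lhd> G"
    by (rule normal_subsetI)
      (auto simp: W_def U_one U_mult U_conj U_pow_mult nat_pow_conj U_carrier)
  then consider "W = {\<one>}" | "W = U" using irred by (auto simp: W_def)
  then show ?thesis
  proof cases
    case 1
    have "v \<in> U \<Longrightarrow> v [^] (p ^ j) = \<one> \<Longrightarrow> v = \<one>" for v j
    proof (induction j)
      case (Suc j)
      have "v [^] (p ^ j) \<in> W"
        using Suc.prems U_pow[of v "p ^ j"] U_carrier by (simp add: W_def nat_pow_pow mult.commute)
      then show ?case using 1 Suc by blast
    qed (simp add: U_carrier)
    then have "u = \<one>" using subgroup_pow_card[OF U_sub assms] card_U assms by metis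
    then show ?thesis by simp
  qed (use assms in \<open>auto simp: W_def\<close>)
qed

text \<open>
  The eigenspace is normal in \<open>G\<close> because the action is abelian, and irreducibility does the
  rest.
\<close>

lemma acts_as_power_if_eigenvector:
  assumes g: "g \<in> carrier G" and v: "v \<in> U" "v \<noteq> \<one>" "g \<otimes> v \<otimes> inv g = v [^] (a::nat)"
    and u: "u \<in> U"
  shows "g \<otimes> u \<otimes> inv g = u [^] a"
proof -
  define W where "W = {u \<in> U. g \<otimes> u \<otimes> inv g = u [^] a}"
  have "W \<lhd> G"
  proof (rule normal_subsetI)
    show "x \<otimes> y \<in> W" if "x \<in> W" "y \<in> W" for x y
      using that g by (auto simp: W_def U_mult U_pow_mult conj_mult U_carrier)
    show "k \<otimes> x \<otimes> inv k \<in> W" if k: "k \<in> carrier G" and "x \<in> W" for k x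
    proof -
      have x: "x \<in> U" "x \<in> carrier G" "g \<otimes> x \<otimes> inv g = x [^] a" using that by (auto simp: W_def U_carrier)
      have "g \<otimes> (k \<otimes> x \<otimes> inv k) \<otimes> inv g = k \<otimes> (g \<otimes> x \<otimes> inv g) \<otimes> inv k"
        using abelian_action[OF g k x(1)] g k x(2) by (simp only: conj_conj)
      then show ?thesis using x g k by (simp add: W_def U_conj nat_pow_conj)
    qed
  qed (use g in \<open>auto simp: W_def U_one\<close>)
  then have "W = U" using irred[of W] v by (auto simp: W_def)
  then show ?thesis using u by (auto simp: W_def)
qed

definition centralizer where
  "centralizer = {g \<in> carrier G. \<forall>u\<in>U. g \<otimes> u \<otimes> inv g = u}"

lemma centralizer_subgroup: "subgroup centralizer G"
  by (rule finite_mult_closed_imp_subgroup[OF fin])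
    (auto simp: centralizer_def U_carrier conj_conj simp del: inv_mult_group)

text \<open>
  A \<open>p\<close>-element fixes some nonidentity element of \<open>U\<close> when \<open>U\<close> is nontrivial; such an element is an
  eigenvector with eigenvalue \<open>1\<close>.
\<close>

lemma p_element_centralizes:
  assumes z: "z \<in> carrier G" "z [^] (p ^ k) = \<one>"
  shows "z \<in> centralizer"
proof (cases "U = {\<one>}")
  case False
  have finU: "finite U" using U_carrier fin by (meson finite_subset subsetI)
  have "card U \<noteq> 1" using False U_one by (auto simp: card_1_singleton_iff)
  then have "p dvd card U" using card_U by (cases m) auto
  moreover have "card U = card (U - {\<one>}) + 1" using card_Suc_Diff1[OF finU U_one] by simp
  ultimately have ndvd: "\<not> p dvd card (U - {\<one>})"
    using p by (metis dvd_add_right_iff not_prime_unit)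
  have "\<exists>x\<in>U - {\<one>}. z \<otimes> x = x \<otimes> z"
  proof (rule conj_fixed_point[OF z p _ _ ndvd])
    show "z \<otimes> x \<otimes> inv z \<in> U - {\<one>}" if "x \<in> U - {\<one>}" for x
    proof -
      have "z \<otimes> x \<otimes> inv z \<noteq> \<one>"
      proof
        assume "z \<otimes> x \<otimes> inv z = \<one>"
        then have "z \<otimes> x = z" using z that U_carrier by (metis DiffD1 inv_solve_right' l_one m_closed one_closed)
        then show False using z that U_carrier by auto
      qed
      then show ?thesis using U_conj z that by blast
    qed
  qed (use finU U_carrier in auto)
  then obtain x where x: "x \<in> U" "x \<noteq> \<one>" "z \<otimes> x = x \<otimes> z" by blast
  then have "z \<otimes> x \<otimes> inv z = x [^] (1::nat)" using z U_carrier[OF x(1)] by (simp add: m_assoc)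
  from acts_as_power_if_eigenvector[OF z(1) x(1,2) this] show ?thesis
    using z U_carrier by (simp add: centralizer_def)
next
  case True
  then show ?thesis unfolding centralizer_def using z by auto
qed

text \<open>
  The image of \<open>G\<close> in the automorphism group of \<open>U\<close> has no elements of order \<open>p\<close>.
\<close>

lemma centralizes_if_p_pow_centralizes:
  assumes z: "z \<in> carrier G" "z [^] (p ^ k) \<in> centralizer"
  shows "z \<in> centralizer"
proof (rule in_subgroup_if_pows_in_subgroup[OF centralizer_subgroup z(1) fin])
  fix r :: nat assume r: "Factorial_Ring.prime r"
  show "\<exists>s. \<not> r dvd s \<and> z [^] s \<in> centralizer"
  proof (cases "r = p")
    case True
    obtain s j where s: "\<not> p dvd s" "(z [^] s) [^] (p ^ j) = \<one>"
      using ord_prime_part[OF fin z(1) p] by blast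
    then have "z [^] s \<in> centralizer" using p_element_centralizes[of "z [^] s" j] z(1) by simp
    then show ?thesis using True s by blast
  next
    case False
    then have "\<not> r dvd p ^ k" using p r by (metis prime_dvd_power primes_dvd_imp_eq)
    then show ?thesis using z by blast
  qed
qed

lemma acts_as_power_if_pow_centralizes:
  assumes y: "y \<in> carrier G" "y [^] (p - 1) \<in> centralizer"
  shows "\<exists>a::nat. \<forall>u\<in>U. y \<otimes> u \<otimes> inv y = u [^] a"
proof (cases "U = {\<one>}")
  case True
  then show ?thesis using y by auto
next
  case False
  let ?U = "G\<lparr>carrier := U\<rparr>"
  interpret U: group ?U using U_sub by (rule subgroup_imp_group)
  interpret U: comm_group ?U by (rule U.group_comm_groupI) (simp add: U_comm)
  define \<sigma> where "\<sigma> u = y \<otimes> u \<otimes> inv y" for u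
  have iter: "(\<sigma> ^^ j) u = y [^] j \<otimes> u \<otimes> inv (y [^] j)" if "u \<in> U" for j u
  proof (induction j)
    case (Suc j)
    then show ?case using conj_by_pow_Suc[of y u j] y that U_carrier by (simp add: \<sigma>_def)
  qed (use that U_carrier in simp)
  obtain v where v: "v \<in> U" "v \<noteq> \<one>" using False U_one by blast
  have "\<exists>u\<in>carrier ?U. u \<noteq> \<one>\<^bsub>?U\<^esub> \<and> (\<exists>a::nat. \<sigma> u = u [^]\<^bsub>?U\<^esub> a)"
  proof (rule U.eigenvector_of_automorphism[OF p, where v = v])
    show "\<sigma> \<in> hom ?U ?U"
      by (rule homI) (auto simp: \<sigma>_def U_conj y conj_mult U_carrier)
    show "x [^]\<^bsub>?U\<^esub> p = \<one>\<^bsub>?U\<^esub>" if "x \<in> carrier ?U" for x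
      using that U_exp_p by (simp flip: nat_pow_consistent)
    show "(\<sigma> ^^ (p - 1)) x = x" if "x \<in> carrier ?U" for x
      using that y(2) iter[of x "p - 1"] by (simp add: centralizer_def)
  qed (use v in auto)
  then obtain u and a :: nat where "u \<in> U" "u \<noteq> \<one>" "y \<otimes> u \<otimes> inv y = u [^] a"
    by (auto simp: \<sigma>_def simp flip: nat_pow_consistent)
  then show ?thesis using acts_as_power_if_eigenvector[OF y(1)] by blast
qed

text \<open>
  The hypothesis makes the \<open>p'\<close>-parts of \<open>y\<close>, raised to the power \<open>(p - 1) * p ^ n\<close>, act trivially;
  its \<open>p\<close>-part acts trivially in any case. Hence \<open>y [^] (p - 1)\<close> acts with \<open>p\<close>-power order, so
  trivially.
\<close>

lemma acts_as_power_if_coprime_parts: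
  fixes n :: nat
  assumes y: "y \<in> carrier G"
    and coprime_part: "\<And>r. Factorial_Ring.prime (r::nat) \<Longrightarrow> r \<noteq> p \<Longrightarrow>
      \<exists>s. \<not> r dvd s \<and> (y [^] (s::nat)) [^] ((p - 1) * p ^ n) \<in> centralizer"
  shows "\<exists>a::nat. \<forall>u\<in>U. y \<otimes> u \<otimes> inv y = u [^] a"
proof -
  let ?e = "(p - 1) * p ^ n"
  have "y [^] ?e \<in> centralizer"
  proof (rule in_subgroup_if_pows_in_subgroup[OF centralizer_subgroup _ fin])
    fix r :: nat assume r: "Factorial_Ring.prime r"
    have "\<exists>s. \<not> r dvd s \<and> (y [^] s) [^] ?e \<in> centralizer"
    proof (cases "r = p")
      case True
      obtain s k where s: "\<not> p dvd s" "(y [^] s) [^] (p ^ k) = \<one>"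
        using ord_prime_part[OF fin y p] by blast
      then have "y [^] s \<in> centralizer" using p_element_centralizes[of "y [^] s" k] y by simp
      then show ?thesis using subgroup_nat_pow_closed[OF centralizer_subgroup] s True by blast
    qed (use coprime_part r in blast)
    then obtain s where s: "\<not> r dvd s" "(y [^] s) [^] ?e \<in> centralizer" by blast
    moreover have "(y [^] ?e) [^] s = (y [^] s) [^] ?e" using y by (simp add: nat_pow_pow mult.commute)
    ultimately show "\<exists>s. \<not> r dvd s \<and> (y [^] ?e) [^] s \<in> centralizer" using s by auto
  qed (use y in simp)
  then have "(y [^] (p - 1)) [^] (p ^ n) \<in> centralizer" using y by (simp add: nat_pow_pow)
  then have "y [^] (p - 1) \<in> centralizer" using centralizes_if_p_pow_centralizes y by blast
  then show ?thesis using acts_as_power_if_pow_centralizes y by blast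
qed

lemma acts_as_power_mult:
  assumes "g \<in> carrier G" "h \<in> carrier G"
    and "\<exists>a::nat. \<forall>u\<in>U. g \<otimes> u \<otimes> inv g = u [^] a"
    and "\<exists>a::nat. \<forall>u\<in>U. h \<otimes> u \<otimes> inv h = u [^] a"
  shows "\<exists>a::nat. \<forall>u\<in>U. (g \<otimes> h) \<otimes> u \<otimes> inv (g \<otimes> h) = u [^] a"
proof -
  obtain a b :: nat where "\<forall>u\<in>U. g \<otimes> u \<otimes> inv g = u [^] a" "\<forall>u\<in>U. h \<otimes> u \<otimes> inv h = u [^] b"
    using assms(3,4) by blast
  then have "(g \<otimes> h) \<otimes> u \<otimes> inv (g \<otimes> h) = u [^] (b * a)" if "u \<in> U" for u
    using that assms(1,2) U_carrier U_pow by (simp only: conj_conj nat_pow_pow)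
  then show ?thesis by blast
qed

end

section \<open>Sylow subgroups and nilpotency\<close>

lemma (in group) subgroup_card_dvd:
  assumes "subgroup S G" "subgroup J G" "S \<subseteq> J"
  shows "card S dvd card J"
proof -
  interpret J: group "G\<lparr>carrier := J\<rparr>" using assms(2) by (rule subgroup_imp_group)
  have "subgroup S (G\<lparr>carrier := J\<rparr>)" using subgroup_incl assms by blast
  from J.lagrange[OF this] show ?thesis unfolding order_def by (metis dvd_triv_right partial_object.select_convs(1) partial_object.surjective partial_object.update_convs(1))
qed

lemma (in group) normal_set_mult:
  assumes "H \<lhd> G" "K \<lhd> G"
  shows "H <#> K \<lhd> G"
  unfolding normal_inv_iff
proof (intro conjI ballI)
  have sub: "subgroup H G" "subgroup K G" using assms by (auto simp: normal_imp_subgroup)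
  show "subgroup (H <#> K) G" using mult_norm_subgroup assms sub by blast
  fix g x assume g: "g \<in> carrier G" and "x \<in> H <#> K"
  then obtain h k where hk: "h \<in> H" "k \<in> K" "x = h \<otimes> k" by (auto simp: set_mult_def)
  have "h \<in> carrier G" "k \<in> carrier G" using hk sub by (auto dest: subgroup.mem_carrier)
  then have "g \<otimes> x \<otimes> inv g = (g \<otimes> h \<otimes> inv g) \<otimes> (g \<otimes> k \<otimes> inv g)"
    using hk g conj_mult by simp
  then show "g \<otimes> x \<otimes> inv g \<in> H <#> K"
    using assms g hk unfolding normal_inv_iff set_mult_def by blast
qed

lemma (in group) set_mult_supersets:
  assumes "subgroup H G" "subgroup K G"
  shows "H \<subseteq> H <#> K" "K \<subseteq> H <#> K"
proof -
  show "H \<subseteq> H <#> K"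
  proof
    fix h assume "h \<in> H"
    then have "h = h \<otimes> \<one>" "\<one> \<in> K" using assms by (auto dest: subgroup.mem_carrier subgroup.one_closed)
    then show "h \<in> H <#> K" using \<open>h \<in> H\<close> unfolding set_mult_def by blast
  qed
  show "K \<subseteq> H <#> K"
  proof
    fix k assume "k \<in> K"
    then have "k = \<one> \<otimes> k" "\<one> \<in> H" using assms by (auto dest: subgroup.mem_carrier subgroup.one_closed)
    then show "k \<in> H <#> K" using \<open>k \<in> K\<close> unfolding set_mult_def by blast
  qed
qed

text \<open>
  Modulo \<open>H\<close> the element \<open>x\<close> lies in the image of \<open>K\<close>. This controls the orders of elements of a
  product, and thereby its prime divisors, without a formula for its cardinality.
\<close>

lemma (in group) set_mult_pow_in_normal:
  assumes H: "H \<lhd> G" and K: "subgroup K G" and x: "x \<in> H <#> K"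
  shows "x [^] card K \<in> H"
proof -
  obtain h k where hk: "h \<in> H" "k \<in> K" "x = h \<otimes> k" using x by (auto simp: set_mult_def)
  have c: "h \<in> carrier G" "k \<in> carrier G" 
    using hk K normal_imp_subgroup[OF H] by (auto dest: subgroup.mem_carrier)
  have Hc: "H \<subseteq> carrier G" using H by (simp add: normal_imp_subgroup subgroup.subset)
  have xc: "x \<in> carrier G" using c hk by simp
  have "x \<in> H #> k" using hk by (auto simp: r_coset_def)
  then have "H #> x = H #> k" using normal.rcos_eq_iff[OF H xc c(2)] by simp
  then have "H #> x [^] card K = H #> k [^] card K"
    using normal.rcos_pow[OF H] xc c(2) by metis
  also have "\<dots> = H" using subgroup_pow_card[OF K hk(2)] Hc by simp
  finally show ?thesis using xc H by (meson coset_join1 nat_pow_closed normal_imp_subgroup subgroup.subset)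
qed

lemma (in group) sylow_exists:
  assumes fin: "finite (carrier G)" and q: "Factorial_Ring.prime (q::nat)" and N: "subgroup N G"
  obtains S where "subgroup S G" "S \<subseteq> N" "card S = q ^ multiplicity q (card N)"
proof -
  let ?N = "G\<lparr>carrier := N\<rparr>"
  have finN: "finite N" using fin N by (meson finite_subset subgroup.subset)
  obtain t where t: "card N = q ^ multiplicity q (card N) * t"
    using multiplicity_dvd by (metis dvdE)
  have "\<exists>H. subgroup H ?N \<and> card H = q ^ multiplicity q (card N)"
    using sylow_thm[OF q, of ?N _ t] N finN t by (simp add: order_def subgroup_imp_group)
  then obtain S where S: "subgroup S ?N" "card S = q ^ multiplicity q (card N)" by blast
  have "subgroup S G" using incl_subgroup[OF N S(1)] .
  moreover have "S \<subseteq> N" using subgroup.subset[OF S(1)] by simp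
  ultimately show ?thesis using that S(2) by blast
qed

text \<open>
  A weak form of Cauchy's theorem: \<open>x\<close> is any nontrivial element of a Sylow subgroup.
\<close>

lemma (in group) cauchy_element:
  assumes fin: "finite (carrier G)" and q: "Factorial_Ring.prime (q::nat)" and N: "subgroup N G"
    and dvd: "q dvd card N"
  obtains x k where "x \<in> N" "x \<noteq> \<one>" "x [^] (q ^ k) = \<one>"
proof -
  obtain S where S: "subgroup S G" "S \<subseteq> N" "card S = q ^ multiplicity q (card N)"
    using sylow_exists[OF fin q N] by blast
  have finN: "finite N" using fin N by (meson finite_subset subgroup.subset)
  have "card N \<noteq> 0" using subgroup.finite_imp_card_positive[OF N fin] by simp
  then have "multiplicity q (card N) \<noteq> 0"
    using multiplicity_geI[of "card N" q 1] dvd q not_prime_unit by fastforce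
  then have "card S \<noteq> 1" using S(3) q by (auto simp: prime_gt_1_nat)
  then have "S \<noteq> {\<one>}" by auto
  then obtain x where x: "x \<in> S" "x \<noteq> \<one>" using subgroup.one_closed[OF S(1)] by blast
  show ?thesis using that[of x "multiplicity q (card N)"] x S subgroup_pow_card[OF S(1) x(1)] by auto
qed

lemma (in group) subgroup_eq_if_contains_sylows:
  assumes fin: "finite (carrier G)" and N: "subgroup N G" and J: "subgroup J G" "J \<subseteq> N"
    and syl: "\<And>r. Factorial_Ring.prime (r::nat) \<Longrightarrow> \<exists>S\<subseteq>J. subgroup S G \<and> card S = r ^ multiplicity r (card N)"
  shows "J = N"
proof -
  have pos: "card N > 0" "card J > 0" using subgroup.finite_imp_card_positive fin N J by blast+
  have finN: "finite N" using fin N by (meson finite_subset subgroup.subset)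
  have "card N dvd card J"
  proof (rule multiplicity_le_imp_dvd)
    fix r :: nat assume r: "Factorial_Ring.prime r"
    obtain S where S: "S \<subseteq> J" "subgroup S G" "card S = r ^ multiplicity r (card N)"
      using syl[OF r] by blast
    have "r ^ multiplicity r (card N) dvd card J" using subgroup_card_dvd[OF S(2) J(1) S(1)] S(3) by simp
    then show "multiplicity r (card N) \<le> multiplicity r (card J)"
      using r pos by (intro multiplicity_geI) (auto simp: not_prime_unit)
  qed (use pos in simp)
  then have "card N \<le> card J" using pos by (simp add: dvd_imp_le)
  then show ?thesis using J(2) finN by (meson card_seteq)
qed

lemma (in group) p_element_in_normal_sylow:
  assumes fin: "finite (carrier G)" and q: "Factorial_Ring.prime (q::nat)"
    and S: "S \<lhd> G" "card S = q ^ multiplicity q (order G)"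
    and x: "x \<in> carrier G" "x [^] (q ^ a) = \<one>"
  shows "x \<in> S"
proof -
  interpret S: normal S G by (rule S(1))
  interpret Q: group "G Mod S" by (rule S.factorgroup_is_group)
  have "order (G Mod S) * card S = order G"
    using lagrange[OF S.is_subgroup] by (simp add: order_def FactGroup_def)
  moreover have "order G \<noteq> 0" using fin order_gt_0_iff_finite by simp
  ultimately have "\<not> q dvd order (G Mod S)"
    using S(2) q multiplicity_decompose'[of "order G" q]
    by (metis mult.commute mult_cancel_left not_prime_unit mult_is_0)
  then have "coprime (order (G Mod S)) (q ^ a)"
    using q by (simp add: prime_imp_coprime coprime_commute)
  moreover have "(S #> x) [^]\<^bsub>G Mod S\<^esub> (q ^ a) = \<one>\<^bsub>G Mod S\<^esub>"
    using x by (simp add: S.rcos_pow S.subset)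
  moreover have Sx: "S #> x \<in> carrier (G Mod S)" using x by (auto simp: carrier_FactGroup)
  ultimately have "S #> x = \<one>\<^bsub>G Mod S\<^esub>"
    using Q.coprime_pows_eq_one Q.pow_order_eq_1 by blast
  then show ?thesis using x coset_join1 S.is_subgroup S.subset by simp
qed

lemma (in group) p_group_card:
  assumes fin: "finite (carrier G)" and q: "Factorial_Ring.prime (q::nat)" and S: "subgroup S G"
    and els: "\<And>x. x \<in> S \<Longrightarrow> \<exists>a. x [^] (q ^ a) = \<one>"
  shows "\<exists>n. card S = q ^ n"
proof -
  have pos: "card S > 0" using subgroup.finite_imp_card_positive[OF S fin] .
  obtain t where t: "card S = q ^ multiplicity q (card S) * t" "\<not> q dvd t"
    using multiplicity_decompose'[of "card S" q] pos q not_prime_unit by (metis less_irrefl)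
  have "t = 1"
  proof (rule ccontr)
    assume "t \<noteq> 1"
    then obtain r where r: "Factorial_Ring.prime r" "r dvd t" using prime_factor_nat by blast
    then have "r dvd card S" "r \<noteq> q" using t by (auto, metis dvd_mult)
    then obtain x k where x: "x \<in> S" "x \<noteq> \<one>" "x [^] (r ^ k) = \<one>"
      using cauchy_element[OF fin r(1) S] by blast
    obtain a where "x [^] (q ^ a) = \<one>" using els x by blast
    moreover have "coprime (r ^ k) (q ^ a)" using r q \<open>r \<noteq> q\<close> by (simp add: primes_coprime)
    ultimately show False using coprime_pows_eq_one x S by (meson subgroup.mem_carrier)
  qed
  then show ?thesis using t by auto
qed

text \<open>
  The product of \<open>S\<close> and \<open>R\<close> consists of \<open>q\<close>-elements, so it is a \<open>q\<close>-group and not larger than \<open>R\<close>.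
\<close>

lemma (in group) normal_p_subgroup_le_sylow:
  assumes fin: "finite (carrier G)" and q: "Factorial_Ring.prime (q::nat)"
    and S: "S \<lhd> G" "card S = q ^ k" and R: "subgroup R G" "card R = q ^ multiplicity q (order G)"
  shows "S \<subseteq> R"
proof -
  have S': "subgroup S G" using S by (simp add: normal_imp_subgroup)
  define J where "J = S <#> R"
  have J: "subgroup J G" unfolding J_def using mult_norm_subgroup S R by blast
  have le: "S \<subseteq> J" "R \<subseteq> J" unfolding J_def using set_mult_supersets S' R by blast+
  have finJ: "finite J" using fin J by (meson finite_subset subgroup.subset)
  have "\<exists>a. x [^] (q ^ a) = \<one>" if "x \<in> J" for x
  proof -
    have xc: "x \<in> carrier G" using that J by (rule subgroup.mem_carrier[rotated])
    have "(x [^] card R) [^] card S = \<one>"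
      using subgroup_pow_card[OF S'] set_mult_pow_in_normal[OF S(1) R(1)] that by (simp add: J_def)
    then show ?thesis using xc S(2) R(2) by (auto simp: nat_pow_pow simp flip: power_add)
  qed
  then obtain n where n: "card J = q ^ n" using p_group_card[OF fin q J] by blast
  have "card J dvd order G" using subgroup_card_dvd[OF J subgroup_self] J 
    by (simp add: order_def subgroup.subset)
  moreover have "order G \<noteq> 0" using fin order_gt_0_iff_finite by simp
  ultimately have "n \<le> multiplicity q (order G)"
    using n q by (intro multiplicity_geI) (auto simp: not_prime_unit)
  then have "card J \<le> card R" using n R prime_ge_1_nat[OF q] by (simp add: power_increasing)
  then have "R = J" using card_seteq[OF finJ le(2)] by simp
  then show ?thesis using le by simp
qed

lemma (in group) commutator_one_imp_commute:
  assumes "x \<in> carrier G" "y \<in> carrier G" "x \<otimes> y \<otimes> inv x \<otimes> inv y = \<one>"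
  shows "x \<otimes> y = y \<otimes> x"
  using assms by (metis inv_closed inv_solve_right' l_one m_closed)

lemma (in normal) rcos_commute_iff:
  assumes "x \<in> carrier G" "y \<in> carrier G"
  shows "(H #> x) <#> (H #> y) = (H #> y) <#> (H #> x) \<longleftrightarrow> x \<otimes> y \<otimes> inv x \<otimes> inv y \<in> H"
proof -
  have "(H #> x) <#> (H #> y) = (H #> y) <#> (H #> x) \<longleftrightarrow> x \<otimes> y \<in> H #> (y \<otimes> x)"
    using assms by (simp add: rcos_sum rcos_eq_iff)
  also have "\<dots> \<longleftrightarrow> (x \<otimes> y) \<otimes> inv (y \<otimes> x) \<in> H"
    using rcos_module[OF is_group, of "y \<otimes> x" "x \<otimes> y"] assms by simp
  also have "(x \<otimes> y) \<otimes> inv (y \<otimes> x) = x \<otimes> y \<otimes> inv x \<otimes> inv y"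
    using assms by (simp add: inv_mult_group m_assoc)
  finally show ?thesis .
qed

text \<open>
  The central series with centrality expressed by commutators instead of quotients.
\<close>

lemma (in group) nilpotent_central_series:
  assumes "nilpotent_group G"
  obtains T n where "T 0 = {\<one>}" "T n = carrier G" "\<And>i. i \<le> n \<Longrightarrow> T i \<lhd> G"
    "\<And>i. i < n \<Longrightarrow> T i \<subseteq> T (Suc i)"
    "\<And>i x y. i < n \<Longrightarrow> x \<in> T (Suc i) \<Longrightarrow> y \<in> carrier G \<Longrightarrow> x \<otimes> y \<otimes> inv x \<otimes> inv y \<in> T i"
proof -
  obtain T n where T: "normal_series G T n"
    and c: "\<And>i. i < n \<Longrightarrow> carrier ((G\<lparr>carrier := T (Suc i)\<rparr>) Mod T i) \<subseteq> group_center (G Mod T i)"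
    using assms unfolding nilpotent_group_def by blast
  have "x \<otimes> y \<otimes> inv x \<otimes> inv y \<in> T i" if "i < n" "x \<in> T (Suc i)" "y \<in> carrier G" for i x y
  proof -
    have Ti: "T i \<lhd> G" "T (Suc i) \<lhd> G" using T that by (auto simp: normal_series_def)
    have xc: "x \<in> carrier G" using that Ti(2) by (meson normal_imp_subgroup subgroup.mem_carrier)
    have "T i #> x \<in> group_center (G Mod T i)"
      using c[OF that(1)] that(2) by (auto simp: carrier_FactGroup)
    then have "(T i #> x) <#> (T i #> y) = (T i #> y) <#> (T i #> x)"
      using that(3) by (auto simp: group_center_def carrier_FactGroup)
    then show ?thesis using normal.rcos_commute_iff[OF Ti(1) xc that(3)] by simp
  qed
  then show ?thesis using that T by (auto simp: normal_series_def)
qed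

text \<open>
  The order of \<open>z\<close> divides both \<open>m\<close> and \<open>n\<close>, by \<open>conj_pow_left\<close> applied to \<open>x\<close> acting on \<open>y\<close> and to \<open>y\<close>
  acting on \<open>x\<close>.
\<close>

lemma (in group) commute_if_commutator_central:
  assumes x: "x \<in> carrier G" "x [^] (m::nat) = \<one>" and y: "y \<in> carrier G" "y [^] (n::nat) = \<one>"
    and cop: "coprime m n" and z: "z = x \<otimes> y \<otimes> inv x \<otimes> inv y"
    and zx: "x \<otimes> z = z \<otimes> x" and zy: "y \<otimes> z = z \<otimes> y"
  shows "x \<otimes> y = y \<otimes> x"
proof -
  have zc: "z \<in> carrier G" using z x y by simp
  have "x \<otimes> y \<otimes> inv x = z \<otimes> y" using z x y by (simp add: m_assoc)
  then have "x [^] m \<otimes> y \<otimes> inv (x [^] m) = z [^] m \<otimes> y"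
    using conj_pow_left x y zc zx by blast
  then have zm: "z [^] m = \<one>" using x y zc by simp
  have "y \<otimes> x \<otimes> inv y = inv z \<otimes> x" using z x y by (simp add: m_assoc inv_mult_group)
  moreover have "y \<otimes> inv z = inv z \<otimes> y"
  proof -
    have "inv z \<otimes> y = inv z \<otimes> (y \<otimes> z \<otimes> inv z)" using zc y by (simp add: m_assoc)
    also have "\<dots> = y \<otimes> inv z" unfolding zy using zc y by (simp flip: m_assoc)
    finally show ?thesis by simp
  qed
  ultimately have "y [^] n \<otimes> x \<otimes> inv (y [^] n) = (inv z) [^] n \<otimes> x"
    using conj_pow_left x y zc by blast
  then have "inv (z [^] n) = \<one>" using x y zc by (simp add: nat_pow_inv)
  then have "z [^] n = \<one>" using zc by simp
  then have "z = \<one>" using coprime_pows_eq_one zm zc cop by blast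
  then show ?thesis by (intro commutator_one_imp_commute x y) (simp add: z)
qed

text \<open>
  The commutator of \<open>x\<close> and \<open>y\<close> descends the central series: when it lies in one term, it is
  central modulo the next, hence lies in the next.
\<close>

lemma (in group) nilpotent_coprime_commute:
  assumes nil: "nilpotent_group G"
    and x: "x \<in> carrier G" "x [^] (m::nat) = \<one>" and y: "y \<in> carrier G" "y [^] (n::nat) = \<one>"
    and cop: "coprime m n"
  shows "x \<otimes> y = y \<otimes> x"
proof -
  define z where "z = x \<otimes> y \<otimes> inv x \<otimes> inv y"
  have zc: "z \<in> carrier G" using x y by (simp add: z_def)
  obtain T l where T: "T 0 = {\<one>}" "T l = carrier G" "\<And>i. i \<le> l \<Longrightarrow> T i \<lhd> G"
    and central: "\<And>i x y. i < l \<Longrightarrow> x \<in> T (Suc i) \<Longrightarrow> y \<in> carrier G \<Longrightarrow> x \<otimes> y \<otimes> inv x \<otimes> inv y \<in> T i"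
    using nilpotent_central_series[OF nil] by metis
  have "z \<in> T (l - j)" if "j \<le> l" for j
    using that
  proof (induction j)
    case (Suc j)
    define i where "i = l - Suc j"
    have i: "i < l" "Suc i = l - j" using Suc.prems by (auto simp: i_def)
    have zT: "z \<in> T (Suc i)" using Suc i by simp
    interpret Ti: normal "T i" G using T(3) i by simp
    let ?Q = "G Mod T i" and ?f = "\<lambda>x. T i #> x"
    interpret Q: group ?Q by (rule Ti.factorgroup_is_group)
    interpret f: group_hom G ?Q ?f
      by (simp add: group_hom_def group_hom_axioms_def Ti.r_coset_hom_Mod)
    have comm: "?f g \<otimes>\<^bsub>?Q\<^esub> ?f z = ?f z \<otimes>\<^bsub>?Q\<^esub> ?f g" if "g \<in> carrier G" for g
      using Ti.rcos_commute_iff[OF zc that] central[OF i(1) zT that] by simp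
    have "?f x \<otimes>\<^bsub>?Q\<^esub> ?f y = ?f y \<otimes>\<^bsub>?Q\<^esub> ?f x"
    proof (rule Q.commute_if_commutator_central[where z = "?f z" and m = m and n = n])
      show "?f x [^]\<^bsub>?Q\<^esub> m = \<one>\<^bsub>?Q\<^esub>" "?f y [^]\<^bsub>?Q\<^esub> n = \<one>\<^bsub>?Q\<^esub>"
        using x y by (simp_all add: Ti.rcos_pow Ti.subset)
      show "?f z = ?f x \<otimes>\<^bsub>?Q\<^esub> ?f y \<otimes>\<^bsub>?Q\<^esub> inv\<^bsub>?Q\<^esub> (?f x) \<otimes>\<^bsub>?Q\<^esub> inv\<^bsub>?Q\<^esub> (?f y)"
        unfolding z_def using x y by (simp only: f.hom_mult f.hom_inv m_closed inv_closed)
    qed (use x y cop comm f.hom_closed in auto)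
    then show ?case using Ti.rcos_commute_iff[OF x(1) y(1)] by (simp add: z_def i_def)
  qed (use zc T in simp)
  from this[of l] have "z = \<one>" using T by simp
  then show ?thesis by (intro commutator_one_imp_commute x y) (simp add: z_def)
qed

section \<open>Supersolubility and power maps\<close>

lemma (in group) int_pow_conj:
  assumes "g \<in> carrier G" "x \<in> carrier G"
  shows "(g \<otimes> x \<otimes> inv g) [^] (k::int) = g \<otimes> x [^] k \<otimes> inv g"
proof -
  have "group_hom G G (\<lambda>x. g \<otimes> x \<otimes> inv g)"
    using assms(1) by unfold_locales (auto intro!: homI simp: conj_mult)
  then show ?thesis using group_hom.hom_int_pow assms(2) by fastforce
qed

text \<open>
  Generators of cyclic factors come with integer exponents, whereas power maps are stated with
  natural numbers throughout.
\<close>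

lemma (in group) int_pow_as_nat_pow:
  assumes "finite (carrier G)" "x \<in> carrier G"
  shows "\<exists>a::nat. x [^] (k::int) = x [^] a"
proof -
  have ord: "ord x > 0" using ord_ge_1[OF assms] by simp
  then have "0 \<le> k mod int (ord x)" by simp
  then obtain a where a: "k mod int (ord x) = int a" using nonneg_int_cases by blast
  have "int (ord x) dvd int a - k" unfolding a[symmetric] by (metis dvd_minus_mod dvd_diff_commute)
  then have "x [^] k = x [^] int a" using int_pow_eq assms(2) by blast
  then show ?thesis by (metis int_pow_int)
qed

text \<open>
  Conjugation acts on a cyclic factor as an endomorphism, that is, as a power map. In
  this form supersolubility passes to images and sections without further work.
\<close>

lemma (in group) supersoluble_power_series:
  assumes fin: "finite (carrier G)" and ss: "supersoluble_group G"
  obtains N n where "N 0 = {\<one>}" "N n = carrier G" "\<And>i. i \<le> n \<Longrightarrow> N i \<lhd> G"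
    "\<And>i. i < n \<Longrightarrow> N i \<subseteq> N (Suc i)"
    "\<And>i g x. i < n \<Longrightarrow> g \<in> carrier G \<Longrightarrow> x \<in> N (Suc i) \<Longrightarrow>
      \<exists>a::nat. g \<otimes> x \<otimes> inv g \<in> N i #> x [^] a"
proof -
  obtain N n where N: "normal_series G N n"
    and cyc: "\<And>i. i < n \<Longrightarrow> cyclic_group ((G\<lparr>carrier := N (Suc i)\<rparr>) Mod N i)"
    using ss unfolding supersoluble_group_def by blast
  have "\<exists>a::nat. g \<otimes> x \<otimes> inv g \<in> N i #> x [^] a"
    if i: "i < n" and g: "g \<in> carrier G" and x: "x \<in> N (Suc i)" for i g x
  proof -
    have Ni: "N i \<lhd> G" "N (Suc i) \<lhd> G" "N i \<subseteq> N (Suc i)"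
      using N i by (auto simp: normal_series_def)
    let ?S = "G\<lparr>carrier := N (Suc i)\<rparr>" and ?f = "\<lambda>x. N i #> x" and ?Q = "G Mod N i"
    have S: "subgroup (N (Suc i)) G" using Ni(2) by (rule normal_imp_subgroup)
    have NS: "N i \<lhd> ?S" using normal_restrict_supergroup[OF S Ni(1,3)] .
    interpret SQ: group "?S Mod N i" using NS by (rule normal.factorgroup_is_group)
    interpret Q: group ?Q using Ni(1) by (rule normal.factorgroup_is_group)
    interpret f: group_hom G ?Q ?f
      by (simp add: group_hom_def group_hom_axioms_def normal.r_coset_hom_Mod[OF Ni(1)])
    have finQ: "finite (carrier ?Q)" using fin by (simp add: carrier_FactGroup)
    obtain c where c: "c \<in> N (Suc i)"
      and gen: "carrier (?S Mod N i) = range (\<lambda>k::int. (?f c) [^]\<^bsub>?S Mod N i\<^esub> k)"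
      using cyc[OF i] unfolding SQ.cyclic_group by (auto simp: carrier_FactGroup)
    have cc: "c \<in> carrier G" "x \<in> carrier G" using c x S by (auto dest: subgroup.mem_carrier)
    have pow: "\<exists>k::int. ?f y = (?f c) [^]\<^bsub>?Q\<^esub> k" if "y \<in> N (Suc i)" for y
    proof -
      have "?f y \<in> carrier (?S Mod N i)" using that by (auto simp: carrier_FactGroup)
      then obtain k :: int where "?f y = (?f c) [^]\<^bsub>?S Mod N i\<^esub> k" using gen by auto
      also have "\<dots> = ?f (c [^] k)"
        using normal.FactGroup_int_pow[OF NS, of c k] c int_pow_consistent[OF S c] by simp
      also have "\<dots> = (?f c) [^]\<^bsub>?Q\<^esub> k"
        using normal.FactGroup_int_pow[OF Ni(1) cc(1)] by simp
      finally show ?thesis by blast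
    qed
    obtain k :: int where k: "?f x = (?f c) [^]\<^bsub>?Q\<^esub> k" using pow x by blast
    have "g \<otimes> c \<otimes> inv g \<in> N (Suc i)" using Ni(2) c g by (auto simp: normal_inv_iff)
    then obtain l :: int where l: "?f (g \<otimes> c \<otimes> inv g) = (?f c) [^]\<^bsub>?Q\<^esub> l" using pow by blast
    have conj: "?f (g \<otimes> y \<otimes> inv g) = ?f g \<otimes>\<^bsub>?Q\<^esub> ?f y \<otimes>\<^bsub>?Q\<^esub> inv\<^bsub>?Q\<^esub> (?f g)" if "y \<in> carrier G" for y
      using that g by (simp only: f.hom_mult f.hom_inv m_closed inv_closed)
    have fc: "?f c \<in> carrier ?Q" "?f g \<in> carrier ?Q" "?f x \<in> carrier ?Q"
      using f.hom_closed cc g by auto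
    have "?f (g \<otimes> x \<otimes> inv g) = ((?f c) [^]\<^bsub>?Q\<^esub> l) [^]\<^bsub>?Q\<^esub> k"
      using conj[OF cc(2)] conj[OF cc(1)] Q.int_pow_conj[OF fc(2,1)] k l by metis
    also have "\<dots> = ?f x [^]\<^bsub>?Q\<^esub> l"
      using fc Q.int_pow_pow k by (simp add: mult.commute)
    finally obtain a :: nat where "?f (g \<otimes> x \<otimes> inv g) = ?f x [^]\<^bsub>?Q\<^esub> a"
      using Q.int_pow_as_nat_pow[OF finQ fc(3)] by metis
    then have "?f (g \<otimes> x \<otimes> inv g) = ?f (x [^] a)" using normal.rcos_pow[OF Ni(1) cc(2)] by simp
    then have "g \<otimes> x \<otimes> inv g \<in> N i #> x [^] a"
      by (intro normal.rcos_eq_iff[OF Ni(1), THEN iffD1]) (use g cc in auto)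
    then show ?thesis by blast
  qed
  then show ?thesis using that N by (auto simp: normal_series_def)
qed

lemma (in group) normal_cyclic_extension:
  assumes fin: "finite (carrier G)" and K: "K \<lhd> G" and x: "x \<in> carrier G"
    and conj_x: "\<And>g. g \<in> carrier G \<Longrightarrow> \<exists>a::nat. g \<otimes> x \<otimes> inv g \<in> K #> x [^] a"
  defines "L \<equiv> {y. \<exists>a::nat. y \<in> K #> x [^] a}"
  shows "L \<lhd> G" "K \<subseteq> L" "x \<in> L" "cyclic_group ((G\<lparr>carrier := L\<rparr>) Mod K)"
proof -
  interpret K: normal K G by (rule K)
  let ?f = "\<lambda>x. K #> x" and ?Q = "G Mod K"
  interpret Q: group ?Q by (rule K.factorgroup_is_group)
  interpret f: group_hom G ?Q ?f
    by (simp add: group_hom_def group_hom_axioms_def K.r_coset_hom_Mod)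
  have L: "subgroup L G" unfolding L_def by (rule K.rcos_pows_subgroup[OF fin x])
  show KL: "K \<subseteq> L" unfolding L_def by (auto intro!: exI[of _ 0] simp: K.subset)
  show xL: "x \<in> L" unfolding L_def using x K.is_subgroup by (auto intro!: exI[of _ 1] simp: rcos_self)
  have L_iff: "y \<in> L \<longleftrightarrow> (\<exists>a::nat. ?f y = ?f x [^]\<^bsub>?Q\<^esub> a)" if "y \<in> carrier G" for y
    unfolding L_def using that x by (simp add: K.rcos_pow K.rcos_eq_iff)
  have "g \<otimes> y \<otimes> inv g \<in> L" if g: "g \<in> carrier G" and y: "y \<in> L" for g y
  proof -
    have yc: "y \<in> carrier G" using y L by (rule subgroup.mem_carrier[rotated])
    have conj: "?f (g \<otimes> y \<otimes> inv g) = ?f g \<otimes>\<^bsub>?Q\<^esub> ?f y \<otimes>\<^bsub>?Q\<^esub> inv\<^bsub>?Q\<^esub> (?f g)" if "y \<in> carrier G" for y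
      using that g by (simp only: f.hom_mult f.hom_inv m_closed inv_closed)
    obtain a :: nat where a: "?f y = ?f x [^]\<^bsub>?Q\<^esub> a" using y yc L_iff by blast
    obtain b :: nat where "g \<otimes> x \<otimes> inv g \<in> K #> x [^] b" using conj_x[OF g] by blast
    then have "?f (g \<otimes> x \<otimes> inv g) = ?f (x [^] b)"
      by (intro K.rcos_eq_iff[THEN iffD2]) (use g x in auto)
    then have b: "?f (g \<otimes> x \<otimes> inv g) = ?f x [^]\<^bsub>?Q\<^esub> b" using K.rcos_pow[OF x] by simp
    have fc: "?f x \<in> carrier ?Q" "?f g \<in> carrier ?Q" using f.hom_closed x g by auto
    have "?f (g \<otimes> y \<otimes> inv g) = (?f x [^]\<^bsub>?Q\<^esub> b) [^]\<^bsub>?Q\<^esub> a"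
      using conj[OF yc] conj[OF x] Q.nat_pow_conj[OF fc(2,1)] a b by metis
    then have "?f (g \<otimes> y \<otimes> inv g) = ?f x [^]\<^bsub>?Q\<^esub> (b * a)" using fc by (simp only: Q.nat_pow_pow)
    then show ?thesis using L_iff[of "g \<otimes> y \<otimes> inv g"] g yc by blast
  qed
  then show "L \<lhd> G" using L by (simp add: normal_inv_iff)
  let ?S = "G\<lparr>carrier := L\<rparr>"
  have KS: "K \<lhd> ?S" using normal_restrict_supergroup[OF L K KL] .
  interpret SQ: group "?S Mod K" using KS by (rule normal.factorgroup_is_group)
  have fxS: "?f x \<in> carrier (?S Mod K)" using xL by (auto simp: carrier_FactGroup)
  have "C \<in> range (\<lambda>k::int. ?f x [^]\<^bsub>?S Mod K\<^esub> k)" if C: "C \<in> carrier (?S Mod K)" for C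
  proof -
    obtain y where y: "y \<in> L" "C = ?f y" using C by (auto simp: carrier_FactGroup)
    have yc: "y \<in> carrier G" using y(1) L by (rule subgroup.mem_carrier[rotated])
    obtain a :: nat where "?f y = ?f (x [^] a)" using y yc L_iff x by (auto simp: K.rcos_pow)
    also have "\<dots> = ?f x [^]\<^bsub>?S Mod K\<^esub> a"
      using normal.rcos_pow[OF KS, of x a] xL by (simp flip: nat_pow_consistent)
    finally have "C = ?f x [^]\<^bsub>?S Mod K\<^esub> int a" using y by (simp add: int_pow_int)
    then show ?thesis by blast
  qed
  moreover have "?f x [^]\<^bsub>?S Mod K\<^esub> (k::int) \<in> carrier (?S Mod K)" for k
    using SQ.int_pow_closed[OF fxS] .
  ultimately show "cyclic_group (?S Mod K)" unfolding SQ.cyclic_group using fxS by blast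
qed

text \<open>
  A converse of \<open>supersoluble_power_series\<close>, by which a series is built from below.
\<close>

lemma (in group) supersolubleI:
  assumes fin: "finite (carrier G)"
    and step: "\<And>K. K \<lhd> G \<Longrightarrow> K \<noteq> carrier G \<Longrightarrow>
      \<exists>x\<in>carrier G - K. \<forall>g\<in>carrier G. \<exists>a::nat. g \<otimes> x \<otimes> inv g \<in> K #> x [^] a"
  shows "supersoluble_group G"
proof -
  have "\<exists>N n. N 0 = K \<and> N n = carrier G \<and> (\<forall>i\<le>n. N i \<lhd> G) \<and> (\<forall>i<n. N i \<subseteq> N (Suc i)) \<and>
      (\<forall>i<n. cyclic_group ((G\<lparr>carrier := N (Suc i)\<rparr>) Mod N i))" if "K \<lhd> G" for K
    using that
  proof (induction "card (carrier G) - card K" arbitrary: K rule: less_induct)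
    case less
    show ?case
    proof (cases "K = carrier G")
      case True
      then show ?thesis using less.prems by (intro exI[of _ "\<lambda>_. K"] exI[of _ 0]) auto
    next
      case False
      then obtain x where x: "x \<in> carrier G" "x \<notin> K"
        and conj_x: "\<And>g. g \<in> carrier G \<Longrightarrow> \<exists>a::nat. g \<otimes> x \<otimes> inv g \<in> K #> x [^] a"
        using step[OF less.prems] by blast
      define L where "L = {y. \<exists>a::nat. y \<in> K #> x [^] a}"
      note L = normal_cyclic_extension[OF fin less.prems x(1) conj_x, folded L_def]
      have Lc: "L \<subseteq> carrier G" using L(1) by (simp add: normal_imp_subgroup subgroup.subset)
      then have "finite L" using fin finite_subset by blast
      then have "card K < card L" using L(2,3) x by (intro psubset_card_mono) auto
      moreover have "card L \<le> card (carrier G)" using Lc fin by (simp add: card_mono)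
      ultimately have "card (carrier G) - card L < card (carrier G) - card K" by simp
      from less.hyps[OF this L(1)] obtain N n where N: "N 0 = L" "N n = carrier G"
        "\<forall>i\<le>n. N i \<lhd> G" "\<forall>i<n. N i \<subseteq> N (Suc i)"
        "\<forall>i<n. cyclic_group ((G\<lparr>carrier := N (Suc i)\<rparr>) Mod N i)" by blast
      let ?N = "\<lambda>i. case i of 0 \<Rightarrow> K | Suc j \<Rightarrow> N j"
      have "?N 0 = K \<and> ?N (Suc n) = carrier G \<and> (\<forall>i\<le>Suc n. ?N i \<lhd> G) \<and>
        (\<forall>i<Suc n. ?N i \<subseteq> ?N (Suc i)) \<and>
        (\<forall>i<Suc n. cyclic_group ((G\<lparr>carrier := ?N (Suc i)\<rparr>) Mod ?N i))"
        using N L less.prems by (auto split: nat.split)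
      then show ?thesis by (intro exI[of _ ?N] exI[of _ "Suc n"])
    qed
  qed
  from this[OF one_is_normal] show ?thesis
    unfolding supersoluble_group_def normal_series_def by blast
qed

section \<open>Weak normal products\<close>

text \<open>
  The normalizer of \<open>S\<close> in \<open>N\<close> contains \<open>S\<close> and the Sylow subgroups for all other primes, so \<open>S\<close> is
  normal in \<open>N\<close>. Then it contains every \<open>q\<close>-element of \<open>N\<close>, in particular its conjugates under \<open>G\<close>.
\<close>

lemma (in group) sylow_normal_if_coprime_elements_commute:
  assumes fin: "finite (carrier G)" and N: "N \<lhd> G"
    and comm: "\<And>x y m n. x \<in> N \<Longrightarrow> y \<in> N \<Longrightarrow> x [^] (m::nat) = \<one> \<Longrightarrow> y [^] (n::nat) = \<one> \<Longrightarrow>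
      coprime m n \<Longrightarrow> x \<otimes> y = y \<otimes> x"
    and q: "Factorial_Ring.prime (q::nat)"
    and S: "subgroup S G" "S \<subseteq> N" "card S = q ^ multiplicity q (card N)"
  shows "S \<lhd> G"
proof -
  have Nsub: "subgroup N G" using N by (rule normal_imp_subgroup)
  have Nc: "N \<subseteq> carrier G" using Nsub by (rule subgroup.subset)
  let ?N = "G\<lparr>carrier := N\<rparr>"
  interpret Ng: group ?N using Nsub by (rule subgroup_imp_group)
  define J where "J = {y \<in> carrier G. \<forall>s\<in>S. y \<otimes> s \<otimes> inv y \<in> S} \<inter> N"
  have "J = N"
  proof (rule subgroup_eq_if_contains_sylows[OF fin Nsub])
    show "subgroup J G" unfolding J_def
      using subgroups_Inter_pair[OF normalizing_elements_subgroup[OF fin S(1)] Nsub] .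
    show "J \<subseteq> N" by (simp add: J_def)
    show "\<exists>T\<subseteq>J. subgroup T G \<and> card T = r ^ multiplicity r (card N)" if r: "Factorial_Ring.prime r" for r
    proof (cases "r = q")
      case True
      have "S \<subseteq> J" using S Nc
        by (auto simp: J_def intro!: subgroup.m_closed[OF S(1)] subgroup.m_inv_closed[OF S(1)])
      then show ?thesis using S True by blast
    next
      case False
      obtain T where T: "subgroup T G" "T \<subseteq> N" "card T = r ^ multiplicity r (card N)"
        using sylow_exists[OF fin r Nsub] by blast
      have cop: "coprime (card T) (card S)" using T S r q False by (simp add: primes_coprime)
      have "y \<in> J" if y: "y \<in> T" for y
      proof -
        have yc: "y \<in> carrier G" using y T Nc by blast
        have "y \<otimes> s \<otimes> inv y \<in> S" if s: "s \<in> S" for s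
        proof -
          have "y \<otimes> s = s \<otimes> y"
            using comm[OF _ _ subgroup_pow_card[OF T(1) y] subgroup_pow_card[OF S(1) s] cop] y s T S by blast
          moreover have "s \<in> carrier G" using s S Nc by blast
          ultimately show ?thesis using s yc by (simp add: m_assoc)
        qed
        then show ?thesis using y yc T by (auto simp: J_def)
      qed
      then show ?thesis using T by blast
    qed
  qed
  then have norm: "y \<otimes> s \<otimes> inv y \<in> S" if "y \<in> N" "s \<in> S" for y s using that by (auto simp: J_def)
  have SN: "S \<lhd> ?N"
    unfolding Ng.normal_inv_iff using subgroup_incl[OF S(1) Nsub S(2)] norm Nsub by auto
  have "g \<otimes> s \<otimes> inv g \<in> S" if g: "g \<in> carrier G" and s: "s \<in> S" for g s
  proof -
    have sc: "s \<in> carrier G" using s S Nc by blast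
    have "g \<otimes> s \<otimes> inv g \<in> N" using N g s S by (auto simp: normal_inv_iff)
    moreover have "(g \<otimes> s \<otimes> inv g) [^] card S = \<one>"
      using subgroup_pow_card[OF S(1) s] g sc by (simp add: nat_pow_conj)
    ultimately show ?thesis
      using Ng.p_element_in_normal_sylow[OF _ q SN] S(3) Nc fin
      by (simp add: order_def finite_subset flip: nat_pow_consistent)
  qed
  then show ?thesis using S by (simp add: normal_inv_iff)
qed

text \<open>
  \<open>K\<close> is a largest normal \<open>p'\<close>-subgroup inside \<open>N\<close>: multiplying it by a Sylow subgroup of \<open>N\<close> for
  another prime gives a normal \<open>p'\<close>-subgroup again.
\<close>

lemma (in group) exists_coprime_core:
  assumes fin: "finite (carrier G)" and N: "N \<lhd> G" and p: "Factorial_Ring.prime (p::nat)"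
    and syl: "\<And>q S. Factorial_Ring.prime (q::nat) \<Longrightarrow> subgroup S G \<Longrightarrow> S \<subseteq> N \<Longrightarrow>
      card S = q ^ multiplicity q (card N) \<Longrightarrow> S \<lhd> G"
  obtains K where "K \<lhd> G" "K \<subseteq> N" "\<not> p dvd card K"
    "\<And>q S. Factorial_Ring.prime (q::nat) \<Longrightarrow> q \<noteq> p \<Longrightarrow> subgroup S G \<Longrightarrow> S \<subseteq> N \<Longrightarrow>
      card S = q ^ multiplicity q (card N) \<Longrightarrow> S \<subseteq> K"
proof -
  define F where "F = {K. K \<lhd> G \<and> K \<subseteq> N \<and> \<not> p dvd card K}"
  have Nsub: "subgroup N G" using N by (rule normal_imp_subgroup)
  have finN: "finite N" using fin Nsub by (meson finite_subset subgroup.subset)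
  have "F \<subseteq> Pow N" by (auto simp: F_def)
  then have "finite F" using finN by (meson finite_Pow_iff finite_subset)
  moreover have "{\<one>} \<in> F"
    using one_is_normal subgroup.one_closed[OF Nsub] p by (auto simp: F_def not_prime_unit)
  ultimately obtain K where K: "K \<in> F" and max: "\<forall>K'\<in>F. K \<subseteq> K' \<longrightarrow> K = K'"
    by (metis finite_has_maximal2)
  have Kn: "K \<lhd> G" "K \<subseteq> N" "\<not> p dvd card K" using K by (auto simp: F_def)
  have Ks: "subgroup K G" using Kn by (simp add: normal_imp_subgroup)
  have "S \<subseteq> K" if q: "Factorial_Ring.prime (q::nat)" "q \<noteq> p" and S: "subgroup S G" "S \<subseteq> N"
      "card S = q ^ multiplicity q (card N)" for q S
  proof -
    have Sn: "S \<lhd> G" using syl q S by blast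
    have KS: "K <#> S \<lhd> G" using normal_set_mult Kn Sn by blast
    have le: "K \<subseteq> K <#> S" "S \<subseteq> K <#> S" using set_mult_supersets Ks S by blast+
    have "K <#> S \<subseteq> N"
      using Kn S unfolding set_mult_def by (auto intro!: subgroup.m_closed[OF Nsub])
    moreover have "\<not> p dvd card (K <#> S)"
    proof
      assume "p dvd card (K <#> S)"
      then obtain x k where x: "x \<in> K <#> S" "x \<noteq> \<one>" "x [^] (p ^ k) = \<one>"
        using cauchy_element[OF fin p normal_imp_subgroup[OF KS]] by blast
      have xc: "x \<in> carrier G" using x normal_imp_subgroup[OF KS] by (meson subgroup.mem_carrier)
      have "(x [^] card S) [^] card K = \<one>"
        using subgroup_pow_card[OF Ks] set_mult_pow_in_normal[OF Kn(1) S(1) x(1)] by blast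
      then have "x [^] (card S * card K) = \<one>" using xc by (simp add: nat_pow_pow)
      moreover have "coprime (card S * card K) (p ^ k)"
        using S(3) Kn(3) p q by (simp add: primes_coprime prime_imp_coprime coprime_commute)
      ultimately show False using coprime_pows_eq_one xc x by blast
    qed
    ultimately have "K <#> S \<in> F" using KS by (simp add: F_def)
    then have "K <#> S = K" using max le by blast
    then show ?thesis using le by blast
  qed
  then show ?thesis using that Kn by blast
qed

text \<open>
  A Sylow \<open>p\<close>-subgroup \<open>R\<close> of \<open>A\<close> need not be normal in \<open>G\<close>, but its image \<open>P\<close> modulo the subgroup \<open>K\<close> of
  \<open>exists_coprime_core\<close> is, since \<open>N \<subseteq> KR\<close> and conjugation by elements of \<open>G\<close> moves elements of \<open>A\<close>
  only within their cosets of \<open>N\<close>. Reduction modulo \<open>K\<close> is injective on \<open>R\<close>, so it puts the maximal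
  subgroups of \<open>R\<close>, to which permutability applies, in bijection with those of \<open>P\<close>, and the
  conclusion of \<open>coprime_action_trivial\<close> can be lifted back to \<open>S \<subseteq> R\<close>.
\<close>

lemma (in group) weak_normal_product_sylow_action:
  fixes p :: nat
  assumes fin: "finite (carrier G)" and wnp: "weak_normal_product G A B"
    and ssB: "supersoluble_group (G\<lparr>carrier := B\<rparr>)"
    and N: "N \<lhd> G" "N \<subseteq> A"
    and comm_N: "\<And>g a. g \<in> carrier G \<Longrightarrow> a \<in> A \<Longrightarrow> g \<otimes> a \<otimes> inv g \<otimes> inv a \<in> N"
    and syl: "\<And>q S. Factorial_Ring.prime (q::nat) \<Longrightarrow> subgroup S G \<Longrightarrow> S \<subseteq> N \<Longrightarrow>
      card S = q ^ multiplicity q (card N) \<Longrightarrow> S \<lhd> G"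
    and p: "Factorial_Ring.prime p"
    and S: "subgroup S G" "S \<subseteq> N" "card S = p ^ multiplicity p (card N)"
    and r: "Factorial_Ring.prime (r::nat)" "r \<noteq> p"
    and w: "w \<in> B" "w [^] (r ^ k) = \<one>"
    and s: "s \<in> S"
  shows "w [^] ((p - 1) * p ^ multiplicity p (card A)) \<otimes> s = s \<otimes> w [^] ((p - 1) * p ^ multiplicity p (card A))"
proof -
  let ?n = "multiplicity p (card A)"
  let ?e = "(p - 1) * p ^ ?n"
  have A: "subgroup A G" "A \<lhd> G" and B: "subgroup B G"
    using wnp by (auto simp: weak_normal_product_def)
  have Sn: "S \<lhd> G" using syl p S by blast
  have Nsub: "subgroup N G" using N by (simp add: normal_imp_subgroup)
  have Ac: "A \<subseteq> carrier G" and Bc: "B \<subseteq> carrier G" using A B by (auto dest: subgroup.subset)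
  let ?A = "G\<lparr>carrier := A\<rparr>"
  interpret Ag: group ?A using A(1) by (rule subgroup_imp_group)
  have finA: "finite (carrier ?A)" using Ac fin by (simp add: finite_subset)
  obtain R where R: "subgroup R G" "R \<subseteq> A" "card R = p ^ ?n"
    using sylow_exists[OF fin p A(1)] by blast
  have RA: "subgroup R ?A" using subgroup_incl[OF R(1) A(1) R(2)] .
  have Rc: "R \<subseteq> carrier G" using R Ac by blast
  have "S \<subseteq> R"
  proof (rule Ag.normal_p_subgroup_le_sylow[OF finA p _ S(3) RA])
    show "S \<lhd> ?A" using normal_restrict_supergroup[OF A(1) Sn] S(2) N(2) by blast
    show "card R = p ^ multiplicity p (order ?A)" using R by (simp add: order_def)
  qed
  obtain K where K: "K \<lhd> G" "K \<subseteq> N" "\<not> p dvd card K"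
    and syl_K: "\<And>q S. Factorial_Ring.prime (q::nat) \<Longrightarrow> q \<noteq> p \<Longrightarrow> subgroup S G \<Longrightarrow> S \<subseteq> N \<Longrightarrow>
      card S = q ^ multiplicity q (card N) \<Longrightarrow> S \<subseteq> K"
    by (rule exists_coprime_core[OF fin N(1) p]) (use syl in blast)+
  have Ks: "subgroup K G" using K by (simp add: normal_imp_subgroup)
  have KR: "subgroup (K <#> R) G" using mult_norm_subgroup K R by blast
  have KR_le: "K \<subseteq> K <#> R" "R \<subseteq> K <#> R" using set_mult_supersets Ks R by blast+
  \<comment> \<open>\<open>K\<close> contains the Sylow subgroups of \<open>N\<close> for the primes other than \<open>p\<close>, and \<open>R\<close> contains the one
      for \<open>p\<close>.\<close>
  have N_KR: "N \<subseteq> K <#> R"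
  proof -
    have "(K <#> R) \<inter> N = N"
    proof (rule subgroup_eq_if_contains_sylows[OF fin Nsub])
      show "subgroup ((K <#> R) \<inter> N) G" using subgroups_Inter_pair KR Nsub by blast
      show "\<exists>T\<subseteq>(K <#> R) \<inter> N. subgroup T G \<and> card T = q ^ multiplicity q (card N)"
        if q: "Factorial_Ring.prime q" for q
      proof (cases "q = p")
        case True
        then show ?thesis using S \<open>S \<subseteq> R\<close> KR_le by blast
      next
        case False
        obtain T where "subgroup T G" "T \<subseteq> N" "card T = q ^ multiplicity q (card N)"
          using sylow_exists[OF fin q Nsub] by blast
        then show ?thesis using syl_K[OF q False] KR_le by blast
      qed
    qed simp
    then show ?thesis by blast
  qed
  have KR_one: "x = \<one>" if "x \<in> K" "x \<in> R" for x
  proof (rule coprime_pows_eq_one)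
    show "x \<in> carrier G" using that Rc by blast
    show "x [^] card K = \<one>" "x [^] card R = \<one>" using subgroup_pow_card Ks R that by blast+
    show "coprime (card K) (card R)"
      using K(3) R(3) p by (simp add: prime_imp_coprime coprime_commute)
  qed
  let ?H = "G Mod K" and ?f = "\<lambda>x. K #> x"
  interpret K: normal K G by (rule K(1))
  interpret H: group ?H by (rule K.factorgroup_is_group)
  interpret f: group_hom G ?H ?f
    by (simp add: group_hom_def group_hom_axioms_def K.r_coset_hom_Mod)
  have f_conj: "?f g \<otimes>\<^bsub>?H\<^esub> ?f x \<otimes>\<^bsub>?H\<^esub> inv\<^bsub>?H\<^esub> (?f g) = ?f (g \<otimes> x \<otimes> inv g)"
    if "g \<in> carrier G" "x \<in> carrier G" for g x
    using that by (simp only: f.hom_mult f.hom_inv m_closed inv_closed)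
  have finH: "finite (carrier ?H)" using fin by (simp add: carrier_FactGroup)
  define P where "P = ?f ` R"
  define B' where "B' = ?f ` B"
  have Psub: "subgroup P ?H" unfolding P_def using f.subgroup_img_is_subgroup R(1) .
  have B'sub: "subgroup B' ?H" unfolding B'_def using f.subgroup_img_is_subgroup B .
  have Pn: "P \<lhd> ?H"
    unfolding H.normal_inv_iff
  proof (intro conjI ballI Psub)
    fix h x assume "h \<in> carrier ?H" "x \<in> P"
    then obtain g y where g: "g \<in> carrier G" "h = ?f g" and y: "y \<in> R" "x = ?f y"
      by (auto simp: carrier_FactGroup P_def)
    have yc: "y \<in> carrier G" using y Rc by blast
    have "g \<otimes> y \<otimes> inv g \<otimes> inv y \<in> K <#> R" using comm_N[OF g(1)] y R N_KR by blast
    then obtain k z where kz: "k \<in> K" "z \<in> R" "g \<otimes> y \<otimes> inv g \<otimes> inv y = k \<otimes> z"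
      by (auto simp: set_mult_def)
    have c: "k \<in> carrier G" "z \<in> carrier G" using kz K.subset Rc by auto
    have "g \<otimes> y \<otimes> inv g = (g \<otimes> y \<otimes> inv g \<otimes> inv y) \<otimes> y" using g yc by (simp add: m_assoc)
    also have "\<dots> = k \<otimes> (z \<otimes> y)" using kz c yc by (simp add: m_assoc)
    finally have "g \<otimes> y \<otimes> inv g \<in> K #> (z \<otimes> y)" using kz by (auto simp: r_coset_def)
    then have "?f (g \<otimes> y \<otimes> inv g) = ?f (z \<otimes> y)"
      by (intro K.rcos_eq_iff[THEN iffD2]) (use g yc c in auto)
    moreover have "z \<otimes> y \<in> R" using kz y R(1) by (simp add: subgroup.m_closed)
    ultimately show "h \<otimes>\<^bsub>?H\<^esub> x \<otimes>\<^bsub>?H\<^esub> inv\<^bsub>?H\<^esub> h \<in> P"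
      using f_conj[OF g(1) yc] g y by (auto simp: P_def)
  qed
  have inj: "inj_on ?f R"
  proof (rule inj_onI)
    fix x y assume xy: "x \<in> R" "y \<in> R" "?f x = ?f y"
    then have c: "x \<in> carrier G" "y \<in> carrier G" using Rc by auto
    have "x \<otimes> inv y \<in> K"
      using K.rcos_module[OF is_group c(2,1)] K.rcos_eq_iff[OF c] xy(3) by blast
    then have "x \<otimes> inv y = \<one>"
      using KR_one xy R(1) by (simp add: subgroup.m_closed subgroup.m_inv_closed)
    then show "x = y" using c by (metis inv_closed inv_equality inv_inv)
  qed
  then have cardP: "card P = p ^ ?n" using R(3) by (simp add: P_def card_image)
  have wc: "w \<in> carrier G" using w Bc by blast
  have fw: "?f w \<in> B'" "?f w [^]\<^bsub>?H\<^esub> (r ^ k) = \<one>\<^bsub>?H\<^esub>"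
    using w wc by (auto simp: B'_def K.rcos_pow K.subset)
  have max_inv: "?f w \<otimes>\<^bsub>?H\<^esub> x \<otimes>\<^bsub>?H\<^esub> inv\<^bsub>?H\<^esub> (?f w) \<in> M'"
    if M': "maximal_subgroup M' (?H\<lparr>carrier := P\<rparr>)" and BM: "B' \<inter> P \<subseteq> M'" and x: "x \<in> M'" for M' x
  proof -
    have M'P: "subgroup M' (?H\<lparr>carrier := P\<rparr>)" "M' \<noteq> P"
      and M'_max: "\<And>L. subgroup L (?H\<lparr>carrier := P\<rparr>) \<Longrightarrow> M' \<subseteq> L \<Longrightarrow> L = M' \<or> L = P"
      using M' by (auto simp: maximal_subgroup_def)
    have M'_le: "M' \<subseteq> P" using subgroup.subset[OF M'P(1)] by simp
    have M'sub: "subgroup M' ?H" using H.incl_subgroup[OF Psub M'P(1)] .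
    \<comment> \<open>The maximal subgroup of \<open>R\<close> corresponding to \<open>M'\<close>; it permutes with \<open>B\<close>.\<close>
    define M where "M = {y \<in> R. ?f y \<in> M'}"
    have M_img: "M' \<subseteq> ?f ` M" using M'_le by (auto simp: M_def P_def)
    have Msub: "subgroup M G"
    proof (rule finite_mult_closed_imp_subgroup[OF fin])
      show "M \<subseteq> carrier G" using Rc by (auto simp: M_def)
      show "\<one> \<in> M" using subgroup.one_closed[OF R(1)] subgroup.one_closed[OF M'sub] f.hom_one
        by (simp add: M_def)
      show "y \<otimes> z \<in> M" if "y \<in> M" "z \<in> M" for y z
      proof -
        have yz: "y \<in> R" "z \<in> R" "?f y \<in> M'" "?f z \<in> M'" using that by (auto simp: M_def)
        then have "?f (y \<otimes> z) = ?f y \<otimes>\<^bsub>?H\<^esub> ?f z" using Rc by (intro f.hom_mult) auto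
        then show ?thesis using yz subgroup.m_closed[OF M'sub] subgroup.m_closed[OF R(1)]
          by (simp add: M_def)
      qed
    qed
    have "maximal_subgroup M (G\<lparr>carrier := R\<rparr>)"
      unfolding maximal_subgroup_def
    proof (intro conjI allI impI)
      show "subgroup M (G\<lparr>carrier := R\<rparr>)" using subgroup_incl[OF Msub R(1)] by (auto simp: M_def)
      show "M \<noteq> carrier (G\<lparr>carrier := R\<rparr>)"
      proof
        assume "M = carrier (G\<lparr>carrier := R\<rparr>)"
        then have "P \<subseteq> M'" by (auto simp: P_def M_def)
        then show False using M'_le M'P(2) by blast
      qed
      fix L assume L: "subgroup L (G\<lparr>carrier := R\<rparr>) \<and> M \<subseteq> L"
      have L_R: "L \<subseteq> R" using subgroup.subset[of L] L by fastforce
      have "subgroup L G" using incl_subgroup[OF R(1)] L by blast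
      then have "subgroup (?f ` L) ?H" by (rule f.subgroup_img_is_subgroup)
      then have "subgroup (?f ` L) (?H\<lparr>carrier := P\<rparr>)"
        using H.subgroup_incl Psub L_R by (auto simp: P_def)
      moreover have "M' \<subseteq> ?f ` L" using M_img L by blast
      ultimately consider "?f ` L = M'" | "?f ` L = P" using M'_max by blast
      then show "L = M \<or> L = carrier (G\<lparr>carrier := R\<rparr>)"
      proof cases
        case 1
        then have "L \<subseteq> M" using L_R by (auto simp: M_def)
        then show ?thesis using L by blast
      next
        case 2
        then have "L = R" using inj L_R unfolding P_def by (simp add: inj_on_image_eq_iff)
        then show ?thesis by simp
      qed
    qed
    moreover have "sylow_subgroup p R ?A"
      using p RA R(3) by (simp add: sylow_subgroup_def order_def)
    ultimately have perm: "B <#> M = M <#> B"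
      using wnp unfolding weak_normal_product_def permutes_with_def by blast
    obtain y where y: "y \<in> M" "x = ?f y" using M_img x by blast
    \<comment> \<open>From \<open>w y = z b\<close> with \<open>z \<in> M\<close> and \<open>b \<in> B\<close>, the conjugate of \<open>y\<close> by \<open>w\<close> is \<open>z\<close> times an element of \<open>B\<close>;
        the image of the latter lies in \<open>P\<close>, hence in \<open>M'\<close>.\<close>
    have "w \<otimes> y \<in> M <#> B" using perm w(1) y(1) unfolding set_mult_def by blast
    then obtain z b where zb: "z \<in> M" "b \<in> B" "w \<otimes> y = z \<otimes> b" by (auto simp: set_mult_def)
    have c: "y \<in> carrier G" "z \<in> carrier G" "b \<in> carrier G" using y zb Rc Bc by (auto simp: M_def)
    have eq: "?f w \<otimes>\<^bsub>?H\<^esub> x \<otimes>\<^bsub>?H\<^esub> inv\<^bsub>?H\<^esub> (?f w) = ?f z \<otimes>\<^bsub>?H\<^esub> ?f (b \<otimes> inv w)"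
    proof -
      have "w \<otimes> y \<otimes> inv w = z \<otimes> (b \<otimes> inv w)" using zb c wc by (simp add: m_assoc)
      then show ?thesis using f_conj[OF wc c(1)] f.hom_mult[of z "b \<otimes> inv w"] c wc y(2) by simp
    qed
    have fz: "?f z \<in> M'" using zb by (simp add: M_def)
    have "?f w \<otimes>\<^bsub>?H\<^esub> x \<otimes>\<^bsub>?H\<^esub> inv\<^bsub>?H\<^esub> (?f w) \<in> P"
      using Pn M'_le x f.hom_closed[OF wc] unfolding H.normal_inv_iff by blast
    then have zP: "?f z \<otimes>\<^bsub>?H\<^esub> ?f (b \<otimes> inv w) \<in> P" using eq by simp
    have fc: "?f z \<in> carrier ?H" "?f (b \<otimes> inv w) \<in> carrier ?H"
      by (intro f.hom_closed; use c wc in simp)+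
    have "inv\<^bsub>?H\<^esub> (?f z) \<otimes>\<^bsub>?H\<^esub> (?f z \<otimes>\<^bsub>?H\<^esub> ?f (b \<otimes> inv w)) \<in> P"
      using subgroup.m_closed[OF Psub] subgroup.m_inv_closed[OF Psub] fz M'_le zP by blast
    then have "?f (b \<otimes> inv w) \<in> P" using fc H.m_assoc[symmetric] H.l_inv H.l_one H.inv_closed by metis
    moreover have "?f (b \<otimes> inv w) \<in> B'"
      unfolding B'_def using zb w B by (intro imageI) (simp add: subgroup.m_closed subgroup.m_inv_closed)
    ultimately have "?f (b \<otimes> inv w) \<in> M'" using BM by blast
    then show ?thesis using eq fz subgroup.m_closed[OF M'sub] by simp
  qed
  let ?B = "G\<lparr>carrier := B\<rparr>"
  interpret Bg: group ?B using B by (rule subgroup_imp_group)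
  have finB: "finite (carrier ?B)" using Bc fin by (simp add: finite_subset)
  obtain Ns l where Ns: "Ns 0 = {\<one>\<^bsub>?B\<^esub>}" "Ns l = carrier ?B" "\<And>i. i \<le> l \<Longrightarrow> Ns i \<lhd> ?B"
    and Ns_pow: "\<And>i g x. i < l \<Longrightarrow> g \<in> carrier ?B \<Longrightarrow> x \<in> Ns (Suc i) \<Longrightarrow>
      \<exists>a::nat. g \<otimes>\<^bsub>?B\<^esub> x \<otimes>\<^bsub>?B\<^esub> inv\<^bsub>?B\<^esub> g \<in> Ns i #>\<^bsub>?B\<^esub> x [^]\<^bsub>?B\<^esub> a"
    using Bg.supersoluble_power_series[OF finB ssB] by metis
  have Ns_sub: "subgroup (Ns i) G" "Ns i \<subseteq> B" if "i \<le> l" for i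
    using incl_subgroup[OF B] normal_imp_subgroup[OF Ns(3)[OF that]] subgroup.subset by fastforce+
  define D where "D i = ?f ` Ns i \<inter> P" for i
  have D_sub: "subgroup (D i) ?H" if "i \<le> l" for i
    unfolding D_def using H.subgroups_Inter_pair f.subgroup_img_is_subgroup Ns_sub(1)[OF that] Psub by blast
  have "?f w [^]\<^bsub>?H\<^esub> ?e \<otimes>\<^bsub>?H\<^esub> ?f s = ?f s \<otimes>\<^bsub>?H\<^esub> ?f w [^]\<^bsub>?H\<^esub> ?e"
  proof (rule H.coprime_action_trivial[where B = B' and P = P and D = D and l = l and r = r and k = k])
    show "D 0 = {\<one>\<^bsub>?H\<^esub>}"
      using Ns(1) f.hom_one subgroup.one_closed[OF Psub] by (auto simp: D_def)
    show "B' \<inter> P \<subseteq> D l" using Ns(2) by (simp add: D_def B'_def)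
    show "D i \<lhd> ?H\<lparr>carrier := B'\<rparr>" if i: "i \<le> l" for i
    proof -
      interpret B'g: group "?H\<lparr>carrier := B'\<rparr>" using B'sub by (rule H.subgroup_imp_group)
      have le: "D i \<subseteq> B'" using Ns_sub(2)[OF i] by (auto simp: D_def B'_def)
      have "b' \<otimes>\<^bsub>?H\<^esub> x \<otimes>\<^bsub>?H\<^esub> inv\<^bsub>?H\<^esub> b' \<in> D i" if bx: "b' \<in> B'" "x \<in> D i" for b' x
      proof -
        obtain b y where b: "b \<in> B" "b' = ?f b" and y: "y \<in> Ns i" "x = ?f y"
          using bx by (auto simp: B'_def D_def)
        have c: "b \<in> carrier G" "y \<in> carrier G" using b y Bc Ns_sub(2)[OF i] by auto
        have "b \<otimes> y \<otimes> inv b \<in> Ns i"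
          using Ns(3)[OF i] b(1) y(1) B unfolding Bg.normal_inv_iff by auto
        moreover have "b' \<otimes>\<^bsub>?H\<^esub> x \<otimes>\<^bsub>?H\<^esub> inv\<^bsub>?H\<^esub> b' \<in> P"
          using Pn bx(2) f.hom_closed[OF c(1)] b(2) unfolding H.normal_inv_iff by (auto simp: D_def)
        ultimately show ?thesis using f_conj[OF c] b y by (auto simp: D_def)
      qed
      then show ?thesis
        unfolding B'g.normal_inv_iff using H.subgroup_incl[OF D_sub[OF i] B'sub le] B'sub
        by (auto simp del: mult_FactGroup)
    qed
    show "\<exists>a::nat. ?f w \<otimes>\<^bsub>?H\<^esub> x \<otimes>\<^bsub>?H\<^esub> inv\<^bsub>?H\<^esub> (?f w) \<in> D i #>\<^bsub>?H\<^esub> x [^]\<^bsub>?H\<^esub> a"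
      if i: "i < l" and x: "x \<in> D (Suc i)" for i x
    proof -
      obtain y where y: "y \<in> Ns (Suc i)" "x = ?f y" using x by (auto simp: D_def)
      have yB: "y \<in> B" using Ns_sub(2)[of "Suc i"] i y by auto
      have yc: "y \<in> carrier G" using yB Bc by blast
      obtain a :: nat where "w \<otimes> y \<otimes> inv w \<in> Ns i #> y [^] a"
        using Ns_pow[OF i, of w y] w(1) y(1) B yB by (auto simp flip: nat_pow_consistent)
      then obtain z where z: "z \<in> Ns i" "w \<otimes> y \<otimes> inv w = z \<otimes> y [^] a" by (auto simp: r_coset_def)
      have zc: "z \<in> carrier G" using z Ns_sub(2)[of i] i Bc by auto
      have fc: "?f z \<in> carrier ?H" "x \<in> carrier ?H" using f.hom_closed zc yc y by auto
      have eq: "?f w \<otimes>\<^bsub>?H\<^esub> x \<otimes>\<^bsub>?H\<^esub> inv\<^bsub>?H\<^esub> (?f w) = ?f z \<otimes>\<^bsub>?H\<^esub> x [^]\<^bsub>?H\<^esub> a"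
        using f_conj[OF wc yc] z(2) f.hom_mult[of z "y [^] a"] zc yc y(2) K.rcos_pow[OF yc] by simp
      have xP: "x \<in> P" using x by (simp add: D_def)
      have xaP: "x [^]\<^bsub>?H\<^esub> a \<in> P" using H.subgroup_nat_pow_closed[OF Psub xP] .
      have "?f w \<otimes>\<^bsub>?H\<^esub> x \<otimes>\<^bsub>?H\<^esub> inv\<^bsub>?H\<^esub> (?f w) \<in> P"
        using Pn xP f.hom_closed[OF wc] unfolding H.normal_inv_iff by blast
      then have "?f z \<otimes>\<^bsub>?H\<^esub> x [^]\<^bsub>?H\<^esub> a \<otimes>\<^bsub>?H\<^esub> inv\<^bsub>?H\<^esub> (x [^]\<^bsub>?H\<^esub> a) \<in> P"
        using subgroup.m_closed[OF Psub _ subgroup.m_inv_closed[OF Psub xaP]] eq by simp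
      then have "?f z \<in> P" using fc H.m_assoc H.r_inv H.r_one H.nat_pow_closed H.inv_closed by metis
      then have "?f z \<in> D i" using z by (simp add: D_def)
      then show ?thesis unfolding eq by (auto simp: r_coset_def)
    qed
    show "?f s \<in> P" using s \<open>S \<subseteq> R\<close> by (auto simp: P_def)
    show "D i \<subseteq> P" for i by (simp add: D_def)
  qed (use finH p r Pn cardP B'sub fw max_inv in auto)
  then have fcomm: "?f (w [^] ?e) \<otimes>\<^bsub>?H\<^esub> ?f s = ?f s \<otimes>\<^bsub>?H\<^esub> ?f (w [^] ?e)"
    using K.rcos_pow[OF wc] by simp
  have wec: "w [^] ?e \<in> carrier G" and sc: "s \<in> carrier G"
    using wc s S by (auto dest: subgroup.mem_carrier)
  have "w [^] ?e \<otimes> s \<otimes> inv (w [^] ?e) \<otimes> inv s \<in> K"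
    using K.rcos_commute_iff[OF wec sc] fcomm by simp
  moreover have "w [^] ?e \<otimes> s \<otimes> inv (w [^] ?e) \<otimes> inv s \<in> R"
  proof -
    have "w [^] ?e \<otimes> s \<otimes> inv (w [^] ?e) \<in> S" using Sn wec s by (simp add: normal_inv_iff)
    then show ?thesis using subgroup.m_closed[OF S(1)] subgroup.m_inv_closed[OF S(1)] s \<open>S \<subseteq> R\<close> by blast
  qed
  ultimately have "w [^] ?e \<otimes> s \<otimes> inv (w [^] ?e) \<otimes> inv s = \<one>" by (rule KR_one)
  then show ?thesis by (rule commutator_one_imp_commute[OF wec sc])
qed

lemma (in group) minimal_normal_subgroup_exists:
  assumes fin: "finite (carrier G)" and V: "V \<lhd> G" "V \<noteq> {\<one>}"
  obtains U where "U \<lhd> G" "U \<subseteq> V" "U \<noteq> {\<one>}"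
    "\<And>W. W \<lhd> G \<Longrightarrow> W \<subseteq> U \<Longrightarrow> W = {\<one>} \<or> W = U"
proof -
  define F where "F = {U. U \<lhd> G \<and> U \<subseteq> V \<and> U \<noteq> {\<one>}}"
  have "finite V" using fin V by (meson finite_subset normal_imp_subgroup subgroup.subset)
  moreover have "F \<subseteq> Pow V" by (auto simp: F_def)
  ultimately have "finite F" by (meson finite_Pow_iff finite_subset)
  moreover have "V \<in> F" using V by (simp add: F_def)
  ultimately obtain U where U: "U \<in> F" and min: "\<forall>W\<in>F. W \<subseteq> U \<longrightarrow> U = W"
    by (metis finite_has_minimal2)
  show ?thesis
  proof (rule that)
    show "W = {\<one>} \<or> W = U" if "W \<lhd> G" "W \<subseteq> U" for W
    proof (cases "W = {\<one>}")
      case False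
      then have "W \<in> F" using that U by (auto simp: F_def)
      then show ?thesis using min that by blast
    qed simp
  qed (use U in \<open>auto simp: F_def\<close>)
qed

lemma (in group) commutator_in_derived:
  assumes "x \<in> carrier G" "y \<in> carrier G"
  shows "x \<otimes> y \<otimes> inv x \<otimes> inv y \<in> derived G (carrier G)"
  unfolding derived_def using assms by (intro generate.incl) blast

text \<open>
  A minimal normal subgroup \<open>U\<close> of the quotient by \<open>K\<close> is chosen inside the image of \<open>S\<close>; any
  element of \<open>S\<close> that maps to a nonidentity element of \<open>U\<close> serves as \<open>x\<close>, because \<open>A\<close> and \<open>B\<close>, and so
  their product, act on \<open>U\<close> by power maps.
\<close>

lemma (in group) chief_factor_power_element:
  fixes p n :: nat
  assumes fin: "finite (carrier G)" and G: "carrier G = A <#> B"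
    and A: "subgroup A G" and B: "subgroup B G"
    and nil: "nilpotent_group (G\<lparr>carrier := derived G (carrier G)\<rparr>)"
    and ssA: "supersoluble_group (G\<lparr>carrier := A\<rparr>)"
    and p: "Factorial_Ring.prime p"
    and S: "S \<lhd> G" "card S = p ^ j" "S \<subseteq> A" "S \<subseteq> derived G (carrier G)"
    and centr: "\<And>r k w s. Factorial_Ring.prime (r::nat) \<Longrightarrow> r \<noteq> p \<Longrightarrow> w \<in> B \<Longrightarrow> w [^] (r ^ k) = \<one> \<Longrightarrow>
      s \<in> S \<Longrightarrow> w [^] ((p - 1) * p ^ n) \<otimes> s = s \<otimes> w [^] ((p - 1) * p ^ n)"
    and K: "K \<lhd> G" "\<not> S \<subseteq> K"
  shows "\<exists>x\<in>S - K. \<forall>g\<in>carrier G. \<exists>a::nat. g \<otimes> x \<otimes> inv g \<in> K #> x [^] a"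
proof -
  let ?H = "G Mod K" and ?f = "\<lambda>x. K #> x"
  let ?D = "derived G (carrier G)"
  interpret K: normal K G by (rule K(1))
  interpret H: group ?H by (rule K.factorgroup_is_group)
  interpret f: group_hom G ?H ?f
    by (simp add: group_hom_def group_hom_axioms_def K.r_coset_hom_Mod)
  have f_conj: "?f g \<otimes>\<^bsub>?H\<^esub> ?f x \<otimes>\<^bsub>?H\<^esub> inv\<^bsub>?H\<^esub> (?f g) = ?f (g \<otimes> x \<otimes> inv g)"
    if "g \<in> carrier G" "x \<in> carrier G" for g x
    using that by (simp only: f.hom_mult f.hom_inv m_closed inv_closed)
  have surj: "\<exists>g\<in>carrier G. h = ?f g" if "h \<in> carrier ?H" for h
    using that by (auto simp: carrier_FactGroup)
  have finH: "finite (carrier ?H)" using fin by (simp add: carrier_FactGroup)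
  have Ssub: "subgroup S G" using S(1) by (rule normal_imp_subgroup)
  have Sc: "S \<subseteq> carrier G" using Ssub by (rule subgroup.subset)
  have Dn: "?D \<lhd> G" by (rule derived_self_is_normal)
  have Dsub: "subgroup ?D G" using Dn by (rule normal_imp_subgroup)
  have Dc: "?D \<subseteq> carrier G" using Dsub by (rule subgroup.subset)
  have Ac: "A \<subseteq> carrier G" and Bc: "B \<subseteq> carrier G" using A B by (auto dest: subgroup.subset)
  have f_sub: "?f x = \<one>\<^bsub>?H\<^esub> \<longleftrightarrow> x \<in> K" if "x \<in> carrier G" for x
    using that K.rcos_const[OF is_group] coset_join1[OF _ that K.is_subgroup] by auto
  have V: "?f ` S \<lhd> ?H"
    unfolding H.normal_inv_iff
  proof (intro conjI ballI f.subgroup_img_is_subgroup[OF Ssub])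
    fix h v assume "h \<in> carrier ?H" "v \<in> ?f ` S"
    then obtain g s where g: "g \<in> carrier G" "h = ?f g" and s: "s \<in> S" "v = ?f s"
      using surj by blast
    have "g \<otimes> s \<otimes> inv g \<in> S" using S(1) g(1) s(1) by (simp add: normal_inv_iff)
    then show "h \<otimes>\<^bsub>?H\<^esub> v \<otimes>\<^bsub>?H\<^esub> inv\<^bsub>?H\<^esub> h \<in> ?f ` S"
      unfolding g(2) s(2) using f_conj[OF g(1)] s(1) Sc by (metis imageI subsetD)
  qed
  have "?f ` S \<noteq> {\<one>\<^bsub>?H\<^esub>}" using K(2) f_sub Sc by (metis image_eqI singletonD subset_iff)
  then obtain U where U: "U \<lhd> ?H" "U \<subseteq> ?f ` S" "U \<noteq> {\<one>\<^bsub>?H\<^esub>}"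
    and irred: "\<And>W. W \<lhd> ?H \<Longrightarrow> W \<subseteq> U \<Longrightarrow> W = {\<one>\<^bsub>?H\<^esub>} \<or> W = U"
    using H.minimal_normal_subgroup_exists[OF finH V] by metis
  have Usub: "subgroup U ?H" using U(1) by (rule normal_imp_subgroup)
  have U_conj: "h \<otimes>\<^bsub>?H\<^esub> u \<otimes>\<^bsub>?H\<^esub> inv\<^bsub>?H\<^esub> h \<in> U" if "h \<in> carrier ?H" "u \<in> U" for h u
    using U(1) that unfolding H.normal_inv_iff by blast
  have U_lift: "\<exists>s\<in>S. u = ?f s" if "u \<in> U" for u using U(2) that by blast
  have Uc: "u \<in> carrier ?H" if "u \<in> U" for u using Usub that by (rule subgroup.mem_carrier)
  have "\<exists>m. card U = p ^ m"
  proof (rule H.p_group_card[OF finH p Usub])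
    fix u assume "u \<in> U"
    then obtain s where s: "s \<in> S" "u = ?f s" using U_lift by blast
    then have "u [^]\<^bsub>?H\<^esub> (p ^ j) = ?f (s [^] (p ^ j))" using Sc by (auto simp: K.rcos_pow)
    also have "\<dots> = \<one>\<^bsub>?H\<^esub>" using subgroup_pow_card[OF Ssub s(1)] S(2) K.subset by simp
    finally show "\<exists>a. u [^]\<^bsub>?H\<^esub> (p ^ a) = \<one>\<^bsub>?H\<^esub>" by blast
  qed
  then obtain m where card_U: "card U = p ^ m" by blast
  \<comment> \<open>The first term of an ascending series whose image meets \<open>U\<close> nontrivially; modulo the
      preceding term nothing of \<open>U\<close> is lost, so relations modulo that term become equations in
      \<open>U\<close>.\<close>
  have first: "\<exists>i<l. ?f ` T i \<inter> U = {\<one>\<^bsub>?H\<^esub>} \<and> ?f ` T (Suc i) \<inter> U \<noteq> {\<one>\<^bsub>?H\<^esub>}"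
    if "T 0 = {\<one>}" "S \<subseteq> T l" for T l
  proof -
    define Q where "Q i \<longleftrightarrow> ?f ` T i \<inter> U \<noteq> {\<one>\<^bsub>?H\<^esub>}" for i
    have "?f ` T l \<inter> U = U" using U(2) that(2) by blast
    then have "Q l" using U(3) by (simp add: Q_def)
    moreover have "\<not> Q 0"
      using that(1) f.hom_one subgroup.one_closed[OF Usub] by (auto simp: Q_def)
    ultimately have "\<exists>k<l. (\<forall>i\<le>k. \<not> Q i) \<and> Q (Suc k)" by (rule ex_least_nat_less)
    then obtain k where k: "k < l" "\<forall>i\<le>k. \<not> Q i" "Q (Suc k)" by (elim exE conjE)
    have "?f ` T k \<inter> U = {\<one>\<^bsub>?H\<^esub>}"
      using k(2)[rule_format, OF order_refl] unfolding Q_def by (rule notnotD)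
    moreover have "?f ` T (Suc k) \<inter> U \<noteq> {\<one>\<^bsub>?H\<^esub>}" using k(3) unfolding Q_def .
    ultimately show ?thesis using k(1) by (intro exI conjI)
  qed
  \<comment> \<open>The fixed points \<open>W\<close> of the derived subgroup in \<open>U\<close> form a normal subgroup, which is
      nontrivial because it contains the first nontrivial intersection of \<open>U\<close> with the central
      series.\<close>
  have D_centr: "?f d \<otimes>\<^bsub>?H\<^esub> u = u \<otimes>\<^bsub>?H\<^esub> ?f d" if "d \<in> ?D" "u \<in> U" for d u
  proof -
    let ?Dg = "G\<lparr>carrier := ?D\<rparr>"
    interpret Dg: group ?Dg using Dsub by (rule subgroup_imp_group)
    obtain T l where T: "T 0 = {\<one>\<^bsub>?Dg\<^esub>}" "T l = carrier ?Dg" "\<And>i. i \<le> l \<Longrightarrow> T i \<lhd> ?Dg"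
      and central: "\<And>i x y. i < l \<Longrightarrow> x \<in> T (Suc i) \<Longrightarrow> y \<in> carrier ?Dg \<Longrightarrow>
        x \<otimes>\<^bsub>?Dg\<^esub> y \<otimes>\<^bsub>?Dg\<^esub> inv\<^bsub>?Dg\<^esub> x \<otimes>\<^bsub>?Dg\<^esub> inv\<^bsub>?Dg\<^esub> y \<in> T i"
      using Dg.nilpotent_central_series[OF nil] by metis
    obtain i where i: "i < l" "?f ` T i \<inter> U = {\<one>\<^bsub>?H\<^esub>}" "?f ` T (Suc i) \<inter> U \<noteq> {\<one>\<^bsub>?H\<^esub>}"
      using first[of T l] T S(4) by auto
    have T_D: "T (Suc i) \<subseteq> ?D"
      using subgroup.subset[OF normal_imp_subgroup[OF T(3)[of "Suc i"]]] i(1) by simp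
    have "subgroup (T (Suc i)) G"
      using incl_subgroup[OF Dsub normal_imp_subgroup[OF T(3)[of "Suc i"]]] i(1) by simp
    then have one: "\<one>\<^bsub>?H\<^esub> \<in> ?f ` T (Suc i) \<inter> U"
      using f.subgroup_img_is_subgroup subgroup.one_closed[OF Usub] subgroup.one_closed by blast
    define W where "W = {u \<in> U. \<forall>d\<in>?D. ?f d \<otimes>\<^bsub>?H\<^esub> u = u \<otimes>\<^bsub>?H\<^esub> ?f d}"
    obtain v where v: "v \<in> ?f ` T (Suc i)" "v \<in> U" "v \<noteq> \<one>\<^bsub>?H\<^esub>" using i(3) one by blast
    then obtain t where t: "t \<in> T (Suc i)" "v = ?f t" by blast
    have tc: "t \<in> carrier G" "t \<in> ?D" using t T_D Dc by auto
    have "v \<in> W"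
    proof -
      have "?f e \<otimes>\<^bsub>?H\<^esub> v = v \<otimes>\<^bsub>?H\<^esub> ?f e" if e: "e \<in> ?D" for e
      proof -
        have ec: "e \<in> carrier G" using e Dc by blast
        have fe: "?f e \<in> carrier ?H" using f.hom_closed[OF ec] .
        have "t \<otimes> e \<otimes> inv t \<otimes> inv e \<in> T i"
          using central[OF i(1) t(1), of e] e tc Dsub by simp
        moreover have "?f (t \<otimes> e \<otimes> inv t \<otimes> inv e) = v \<otimes>\<^bsub>?H\<^esub> (?f e \<otimes>\<^bsub>?H\<^esub> inv\<^bsub>?H\<^esub> v \<otimes>\<^bsub>?H\<^esub> inv\<^bsub>?H\<^esub> (?f e))"
          unfolding t(2) using tc ec f.hom_closed
          by (simp only: f.hom_mult f.hom_inv m_closed inv_closed H.m_assoc H.m_closed H.inv_closed)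
        moreover have "v \<otimes>\<^bsub>?H\<^esub> (?f e \<otimes>\<^bsub>?H\<^esub> inv\<^bsub>?H\<^esub> v \<otimes>\<^bsub>?H\<^esub> inv\<^bsub>?H\<^esub> (?f e)) \<in> U"
          using subgroup.m_closed[OF Usub v(2)] U_conj[OF fe] subgroup.m_inv_closed[OF Usub v(2)] by blast
        ultimately have "?f (t \<otimes> e \<otimes> inv t \<otimes> inv e) = \<one>\<^bsub>?H\<^esub>" using i(2) by (metis IntI image_eqI singletonD)
        then have "t \<otimes> e \<otimes> inv t \<otimes> inv e \<in> K"
          by (rule f_sub[THEN iffD1, rotated]) (use tc ec in simp)
        then show ?thesis using K.rcos_commute_iff[OF tc(1) ec] t(2) by simp
      qed
      then show ?thesis using v by (simp add: W_def)
    qed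
    moreover have "W \<lhd> ?H"
      unfolding H.normal_inv_iff
    proof (intro conjI ballI)
      show "subgroup W ?H"
      proof (rule H.finite_mult_closed_imp_subgroup[OF finH])
        show "W \<subseteq> carrier ?H" using Uc by (auto simp: W_def)
        have "?f d \<in> carrier ?H" if "d \<in> ?D" for d using f.hom_closed that Dc by blast
        then show "\<one>\<^bsub>?H\<^esub> \<in> W" using subgroup.one_closed[OF Usub] unfolding W_def
          by (auto simp del: one_FactGroup mult_FactGroup)
        show "x \<otimes>\<^bsub>?H\<^esub> y \<in> W" if xy: "x \<in> W" "y \<in> W" for x y
        proof -
          have c: "x \<in> U" "y \<in> U" "x \<in> carrier ?H" "y \<in> carrier ?H" using xy Uc by (auto simp: W_def)
          have "?f d \<otimes>\<^bsub>?H\<^esub> (x \<otimes>\<^bsub>?H\<^esub> y) = x \<otimes>\<^bsub>?H\<^esub> y \<otimes>\<^bsub>?H\<^esub> ?f d" if d: "d \<in> ?D" for d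
          proof -
            have fd: "?f d \<in> carrier ?H" using f.hom_closed d Dc by blast
            have dx: "?f d \<otimes>\<^bsub>?H\<^esub> x = x \<otimes>\<^bsub>?H\<^esub> ?f d" and dy: "?f d \<otimes>\<^bsub>?H\<^esub> y = y \<otimes>\<^bsub>?H\<^esub> ?f d"
              using xy d by (auto simp: W_def)
            have "?f d \<otimes>\<^bsub>?H\<^esub> (x \<otimes>\<^bsub>?H\<^esub> y) = x \<otimes>\<^bsub>?H\<^esub> (?f d \<otimes>\<^bsub>?H\<^esub> y)"
              using c fd H.m_assoc dx by metis
            then show ?thesis using c fd H.m_assoc dy by metis
          qed
          then show ?thesis using subgroup.m_closed[OF Usub c(1,2)] unfolding W_def by blast
        qed
      qed
      fix h x assume h: "h \<in> carrier ?H" and x: "x \<in> W"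
      obtain g where g: "g \<in> carrier G" "h = ?f g" using surj h by blast
      obtain y where y: "y \<in> S" "x = ?f y" using x U_lift[of x] unfolding W_def by blast
      have yc: "y \<in> carrier G" using y Sc by blast
      have "?f d \<otimes>\<^bsub>?H\<^esub> (h \<otimes>\<^bsub>?H\<^esub> x \<otimes>\<^bsub>?H\<^esub> inv\<^bsub>?H\<^esub> h) = h \<otimes>\<^bsub>?H\<^esub> x \<otimes>\<^bsub>?H\<^esub> inv\<^bsub>?H\<^esub> h \<otimes>\<^bsub>?H\<^esub> ?f d"
        if d: "d \<in> ?D" for d
      proof -
        have dc: "d \<in> carrier G" using d Dc by blast
        define d' where "d' = inv g \<otimes> d \<otimes> inv (inv g)"
        have d'D: "d' \<in> ?D" using Dn d inv_closed[OF g(1)] unfolding d'_def normal_inv_iff by blast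
        then have d': "d' \<in> ?D" "d' \<in> carrier G" using Dc by auto
        have dg: "d = g \<otimes> d' \<otimes> inv g" using g(1) dc by (simp add: d'_def m_assoc) (simp flip: m_assoc)
        have fd': "?f d' \<in> carrier ?H" "x \<in> carrier ?H" using f.hom_closed d' yc y by auto
        have "?f d = h \<otimes>\<^bsub>?H\<^esub> ?f d' \<otimes>\<^bsub>?H\<^esub> inv\<^bsub>?H\<^esub> h" using f_conj[OF g(1) d'(2)] g(2) dg by simp
        then show ?thesis
          using H.conj_mult[OF h fd'] H.conj_mult[OF h fd'(2,1)] x d'(1) by (simp add: W_def del: mult_FactGroup)
      qed
      then show "h \<otimes>\<^bsub>?H\<^esub> x \<otimes>\<^bsub>?H\<^esub> inv\<^bsub>?H\<^esub> h \<in> W"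
        using U_conj[OF h] x unfolding W_def by blast
    qed
    moreover have "W \<subseteq> U" by (auto simp: W_def)
    ultimately have "W = U" using irred[of W] v(3) by blast
    then have "u \<in> W" using \<open>u \<in> U\<close> by simp
    then show ?thesis using \<open>d \<in> ?D\<close> unfolding W_def by blast
  qed
  interpret M: minimal_normal_p_subgroup ?H p m U
  proof (rule minimal_normal_p_subgroup.intro[OF H.is_group], rule minimal_normal_p_subgroup_axioms.intro)
    show "finite (carrier ?H)" by (rule finH)
    show "Factorial_Ring.prime p" by (rule p)
    show "U \<lhd> ?H" by (rule U(1))
    show "card U = p ^ m" by (rule card_U)
    show "W = {\<one>\<^bsub>?H\<^esub>} \<or> W = U" if "W \<lhd> ?H" "W \<subseteq> U" for W using irred that by blast
    show "u \<otimes>\<^bsub>?H\<^esub> v = v \<otimes>\<^bsub>?H\<^esub> u" if uv: "u \<in> U" "v \<in> U" for u v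
      using D_centr uv U_lift[OF uv(1)] S(4) by blast
    show "g \<otimes>\<^bsub>?H\<^esub> h \<otimes>\<^bsub>?H\<^esub> u \<otimes>\<^bsub>?H\<^esub> inv\<^bsub>?H\<^esub> (g \<otimes>\<^bsub>?H\<^esub> h) = h \<otimes>\<^bsub>?H\<^esub> g \<otimes>\<^bsub>?H\<^esub> u \<otimes>\<^bsub>?H\<^esub> inv\<^bsub>?H\<^esub> (h \<otimes>\<^bsub>?H\<^esub> g)"
      if g: "g \<in> carrier ?H" and h: "h \<in> carrier ?H" and u: "u \<in> U" for g h u
    proof -
      obtain a b where ab: "a \<in> carrier G" "g = ?f a" "b \<in> carrier G" "h = ?f b" using surj g h by blast
      define c where "c = inv a \<otimes> inv b \<otimes> inv (inv a) \<otimes> inv (inv b)"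
      have c: "c \<in> ?D" "c \<in> carrier G" unfolding c_def using commutator_in_derived[of "inv a" "inv b"] ab by simp_all
      have "a \<otimes> b = b \<otimes> a \<otimes> c" unfolding c_def using ab by (simp add: m_assoc) (simp flip: m_assoc)
      then have gh: "g \<otimes>\<^bsub>?H\<^esub> h = h \<otimes>\<^bsub>?H\<^esub> g \<otimes>\<^bsub>?H\<^esub> ?f c"
        using ab c f.hom_mult m_closed by metis
      have fc: "?f c \<in> carrier ?H" using f.hom_closed c by blast
      have "?f c \<otimes>\<^bsub>?H\<^esub> u \<otimes>\<^bsub>?H\<^esub> inv\<^bsub>?H\<^esub> (?f c) = u"
        using D_centr[OF c(1) u] fc Uc[OF u] by (simp add: H.m_assoc del: mult_FactGroup one_FactGroup)
      then show ?thesis unfolding gh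
        using H.conj_conj[of "h \<otimes>\<^bsub>?H\<^esub> g" "?f c" u] g h fc Uc[OF u] by (simp del: mult_FactGroup)
    qed
  qed
  \<comment> \<open>The eigenvector comes from the first term of the series of \<open>A\<close> that meets \<open>U\<close> nontrivially.\<close>
  have powA: "\<exists>k::nat. \<forall>u\<in>U. ?f a \<otimes>\<^bsub>?H\<^esub> u \<otimes>\<^bsub>?H\<^esub> inv\<^bsub>?H\<^esub> (?f a) = u [^]\<^bsub>?H\<^esub> k" if a: "a \<in> A" for a
  proof -
    have ac: "a \<in> carrier G" using a Ac by blast
    let ?A = "G\<lparr>carrier := A\<rparr>"
    interpret Ag: group ?A using A by (rule subgroup_imp_group)
    have finA: "finite (carrier ?A)" using Ac fin by (simp add: finite_subset)
    obtain T l where T: "T 0 = {\<one>\<^bsub>?A\<^esub>}" "T l = carrier ?A" "\<And>i. i \<le> l \<Longrightarrow> T i \<lhd> ?A"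
      and T_pow: "\<And>i g x. i < l \<Longrightarrow> g \<in> carrier ?A \<Longrightarrow> x \<in> T (Suc i) \<Longrightarrow>
        \<exists>a::nat. g \<otimes>\<^bsub>?A\<^esub> x \<otimes>\<^bsub>?A\<^esub> inv\<^bsub>?A\<^esub> g \<in> T i #>\<^bsub>?A\<^esub> x [^]\<^bsub>?A\<^esub> a"
      using Ag.supersoluble_power_series[OF finA ssA] by metis
    obtain i where i: "i < l" "?f ` T i \<inter> U = {\<one>\<^bsub>?H\<^esub>}" "?f ` T (Suc i) \<inter> U \<noteq> {\<one>\<^bsub>?H\<^esub>}"
      using first[of T l] T S(3) by auto
    have T_A: "T i' \<subseteq> A" "subgroup (T i') G" if "i' \<le> l" for i'
      using subgroup.subset[OF normal_imp_subgroup[OF T(3)[OF that]]]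
        incl_subgroup[OF A normal_imp_subgroup[OF T(3)[OF that]]] by simp_all
    have "subgroup (T (Suc i)) G" using T_A(2) i(1) by simp
    then have one: "\<one>\<^bsub>?H\<^esub> \<in> ?f ` T (Suc i) \<inter> U"
      using f.subgroup_img_is_subgroup subgroup.one_closed[OF Usub] subgroup.one_closed by blast
    obtain v where v: "v \<in> ?f ` T (Suc i)" "v \<in> U" "v \<noteq> \<one>\<^bsub>?H\<^esub>" using i(3) one by blast
    then obtain t where t: "t \<in> T (Suc i)" "v = ?f t" by blast
    have tA: "t \<in> A" using T_A(1)[of "Suc i"] i(1) t by auto
    have tc: "t \<in> carrier G" using tA Ac by blast
    obtain k :: nat where "a \<otimes> t \<otimes> inv a \<in> T i #> t [^] k"
      using T_pow[OF i(1), of a t] a t(1) A tA by (auto simp flip: nat_pow_consistent)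
    then obtain z where z: "z \<in> T i" "a \<otimes> t \<otimes> inv a = z \<otimes> t [^] k" by (auto simp: r_coset_def)
    have zc: "z \<in> carrier G" using z T_A(1)[of i] i Ac by auto
    have fz: "?f z \<in> carrier ?H" using f.hom_closed zc by blast
    have eq: "?f a \<otimes>\<^bsub>?H\<^esub> v \<otimes>\<^bsub>?H\<^esub> inv\<^bsub>?H\<^esub> (?f a) = ?f z \<otimes>\<^bsub>?H\<^esub> v [^]\<^bsub>?H\<^esub> k"
      using f_conj[OF ac tc] z(2) f.hom_mult[of z "t [^] k"] zc tc t(2) K.rcos_pow[OF tc] by simp
    have vk: "v [^]\<^bsub>?H\<^esub> k \<in> U" using M.U_pow v(2) .
    have "?f a \<otimes>\<^bsub>?H\<^esub> v \<otimes>\<^bsub>?H\<^esub> inv\<^bsub>?H\<^esub> (?f a) \<in> U" using U_conj[OF f.hom_closed[OF ac] v(2)] .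
    then have "?f z \<otimes>\<^bsub>?H\<^esub> v [^]\<^bsub>?H\<^esub> k \<otimes>\<^bsub>?H\<^esub> inv\<^bsub>?H\<^esub> (v [^]\<^bsub>?H\<^esub> k) \<in> U"
      using subgroup.m_closed[OF Usub _ subgroup.m_inv_closed[OF Usub vk]] eq by simp
    then have "?f z \<in> U" using fz Uc[OF vk] H.m_assoc H.r_inv H.r_one H.inv_closed by metis
    then have "?f z = \<one>\<^bsub>?H\<^esub>" using i(2) z(1) by blast
    then have "?f a \<otimes>\<^bsub>?H\<^esub> v \<otimes>\<^bsub>?H\<^esub> inv\<^bsub>?H\<^esub> (?f a) = v [^]\<^bsub>?H\<^esub> k"
      using eq Uc[OF vk] H.l_one by simp
    then show ?thesis using M.acts_as_power_if_eigenvector[OF f.hom_closed[OF ac] v(2,3)] by blast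
  qed
  have powB: "\<exists>k::nat. \<forall>u\<in>U. ?f b \<otimes>\<^bsub>?H\<^esub> u \<otimes>\<^bsub>?H\<^esub> inv\<^bsub>?H\<^esub> (?f b) = u [^]\<^bsub>?H\<^esub> k" if b: "b \<in> B" for b
  proof -
    have bc: "b \<in> carrier G" using b Bc by blast
    let ?e = "(p - 1) * p ^ n"
    show ?thesis
    proof (rule M.acts_as_power_if_coprime_parts[OF f.hom_closed[OF bc], of n])
      fix r :: nat assume r: "Factorial_Ring.prime r" "r \<noteq> p"
      obtain s k where s: "\<not> r dvd s" "(b [^] s) [^] (r ^ k) = \<one>"
        using ord_prime_part[OF fin bc r(1)] by blast
      have bs: "b [^] s \<in> B" using subgroup_nat_pow_closed[OF B b] .
      let ?w = "(b [^] s) [^] ?e"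
      have wc: "?w \<in> carrier G" using bc by simp
      have eq: "(?f b [^]\<^bsub>?H\<^esub> s) [^]\<^bsub>?H\<^esub> ?e = ?f ?w"
        using K.rcos_pow[OF bc] K.rcos_pow[of "b [^] s"] bc by simp
      have "?f ?w \<otimes>\<^bsub>?H\<^esub> u \<otimes>\<^bsub>?H\<^esub> inv\<^bsub>?H\<^esub> (?f ?w) = u" if u: "u \<in> U" for u
      proof -
        obtain x where x: "x \<in> S" "u = ?f x" using U_lift[OF u] by blast
        have xc: "x \<in> carrier G" using x Sc by blast
        have "?w \<otimes> x = x \<otimes> ?w" using centr[OF r bs s(2) x(1)] .
        then have "?w \<otimes> x \<otimes> inv ?w = x" using wc xc by (simp add: m_assoc)
        then show ?thesis using f_conj[OF wc xc] x(2) by simp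
      qed
      then have "?f ?w \<in> M.centralizer" using f.hom_closed[OF wc] by (simp add: M.centralizer_def)
      then show "\<exists>s. \<not> r dvd s \<and> (?f b [^]\<^bsub>?H\<^esub> s) [^]\<^bsub>?H\<^esub> ?e \<in> M.centralizer"
        using s(1) eq by metis
    qed
  qed
  obtain u where u: "u \<in> U" "u \<noteq> \<one>\<^bsub>?H\<^esub>" using U(3) subgroup.one_closed[OF Usub] by blast
  obtain x where x: "x \<in> S" "u = ?f x" using U_lift[OF u(1)] by blast
  have xc: "x \<in> carrier G" using x Sc by blast
  have "x \<notin> K" using u x f_sub[OF xc] by blast
  moreover have "\<exists>k::nat. g \<otimes> x \<otimes> inv g \<in> K #> x [^] k" if g: "g \<in> carrier G" for g
  proof -
    obtain a b where ab: "a \<in> A" "b \<in> B" "g = a \<otimes> b" using g unfolding G by (auto simp: set_mult_def)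
    have c: "a \<in> carrier G" "b \<in> carrier G" using ab Ac Bc by auto
    obtain k :: nat where "?f g \<otimes>\<^bsub>?H\<^esub> u \<otimes>\<^bsub>?H\<^esub> inv\<^bsub>?H\<^esub> (?f g) = u [^]\<^bsub>?H\<^esub> k"
      using M.acts_as_power_mult[OF f.hom_closed[OF c(1)] f.hom_closed[OF c(2)] powA[OF ab(1)] powB[OF ab(2)]]
        f.hom_mult[OF c] ab(3) u(1) by metis
    then have "?f (g \<otimes> x \<otimes> inv g) = ?f (x [^] k)"
      using f_conj[OF g xc] x(2) K.rcos_pow[OF xc] by simp
    then have "g \<otimes> x \<otimes> inv g \<in> K #> x [^] k"
      by (intro K.rcos_eq_iff[THEN iffD1]) (use g xc in auto)
    then show ?thesis by blast
  qed
  ultimately show ?thesis using x(1) by blast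
qed

text \<open>
  The three cases of the proof correspond to the position of \<open>K\<close> relative to the chain
  \<open>N \<subseteq> A \<subseteq> G\<close>.
\<close>

lemma (in group) weak_normal_product_supersoluble:
  assumes fin: "finite (carrier G)" and wnp: "weak_normal_product G A B"
    and nil: "nilpotent_group (G\<lparr>carrier := derived G (carrier G)\<rparr>)"
    and ssA: "supersoluble_group (G\<lparr>carrier := A\<rparr>)"
    and ssB: "supersoluble_group (G\<lparr>carrier := B\<rparr>)"
  shows "supersoluble_group G"
proof -
  let ?D = "derived G (carrier G)"
  define N where "N = A \<inter> ?D"
  have A: "subgroup A G" "A \<lhd> G" and B: "subgroup B G" and GAB: "carrier G = A <#> B"
    using wnp by (auto simp: weak_normal_product_def)
  have Dn: "?D \<lhd> G" by (rule derived_self_is_normal)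
  have Dsub: "subgroup ?D G" using Dn by (rule normal_imp_subgroup)
  have Ac: "A \<subseteq> carrier G" and Bc: "B \<subseteq> carrier G" and Dc: "?D \<subseteq> carrier G"
    using A B Dsub by (auto dest: subgroup.subset)
  have Nn: "N \<lhd> G" unfolding N_def using normal_subgroup_intersect A(2) Dn by blast
  have Nsub: "subgroup N G" using Nn by (rule normal_imp_subgroup)
  have conj_A: "g \<otimes> a \<otimes> inv g \<in> A" if "g \<in> carrier G" "a \<in> A" for g a
    using A(2) that by (simp add: normal_inv_iff)
  have comm_N: "g \<otimes> a \<otimes> inv g \<otimes> inv a \<in> N" if "g \<in> carrier G" "a \<in> A" for g a
    using commutator_in_derived[of g a] subgroup.m_closed[OF A(1) conj_A[OF that] subgroup.m_inv_closed[OF A(1) that(2)]] that Ac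
    by (auto simp: N_def)
  interpret Dg: group "G\<lparr>carrier := ?D\<rparr>" using Dsub by (rule subgroup_imp_group)
  have comm: "x \<otimes> y = y \<otimes> x"
    if "x \<in> N" "y \<in> N" "x [^] (m::nat) = \<one>" "y [^] (n::nat) = \<one>" "coprime m n" for x y m n
    using Dg.nilpotent_coprime_commute[OF nil, of x m y n] that by (simp add: N_def flip: nat_pow_consistent)
  have syl: "S \<lhd> G" if "Factorial_Ring.prime (q::nat)" "subgroup S G" "S \<subseteq> N"
    "card S = q ^ multiplicity q (card N)" for q S
    by (rule sylow_normal_if_coprime_elements_commute[OF fin Nn _ that]) (rule comm)
  show ?thesis
  proof (rule supersolubleI[OF fin])
    fix K assume K: "K \<lhd> G" "K \<noteq> carrier G"
    have Ksub: "subgroup K G" using K(1) by (rule normal_imp_subgroup)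
    have Kc: "K \<subseteq> carrier G" using Ksub by (rule subgroup.subset)
    consider "\<not> N \<subseteq> K" | "N \<subseteq> K" "\<not> A \<subseteq> K" | "A \<subseteq> K" by blast
    then show "\<exists>x\<in>carrier G - K. \<forall>g\<in>carrier G. \<exists>a::nat. g \<otimes> x \<otimes> inv g \<in> K #> x [^] a"
    proof cases
      case 1
      have "\<exists>p S. Factorial_Ring.prime (p::nat) \<and> subgroup S G \<and> S \<subseteq> N \<and>
        card S = p ^ multiplicity p (card N) \<and> \<not> S \<subseteq> K"
      proof (rule ccontr)
        assume none: "\<not> ?thesis"
        have "N \<inter> K = N"
        proof (rule subgroup_eq_if_contains_sylows[OF fin Nsub])
          show "subgroup (N \<inter> K) G" using subgroups_Inter_pair Nsub Ksub by blast
          fix r :: nat assume r: "Factorial_Ring.prime r"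
          obtain T where T: "subgroup T G" "T \<subseteq> N" "card T = r ^ multiplicity r (card N)"
            by (rule sylow_exists[OF fin r Nsub])
          then have "T \<subseteq> N \<inter> K" using none r by fast
          then show "\<exists>T\<subseteq>N \<inter> K. subgroup T G \<and> card T = r ^ multiplicity r (card N)"
            using T by (intro exI[of _ T]) simp
        qed simp
        then show False using 1 by blast
      qed
      then obtain p S where p: "Factorial_Ring.prime (p::nat)" and S: "subgroup S G" "S \<subseteq> N"
        "card S = p ^ multiplicity p (card N)" "\<not> S \<subseteq> K" by blast
      have "\<exists>x\<in>S - K. \<forall>g\<in>carrier G. \<exists>a::nat. g \<otimes> x \<otimes> inv g \<in> K #> x [^] a"
      proof (rule chief_factor_power_element[OF fin GAB A(1) B nil ssA p, of S _ "multiplicity p (card A)"])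
        show "S \<lhd> G" using syl p S by blast
        show "S \<subseteq> A" "S \<subseteq> ?D" using S by (auto simp: N_def)
        show "w [^] ((p - 1) * p ^ multiplicity p (card A)) \<otimes> s = s \<otimes> w [^] ((p - 1) * p ^ multiplicity p (card A))"
          if "Factorial_Ring.prime (r::nat)" "r \<noteq> p" "w \<in> B" "w [^] (r ^ k) = \<one>" "s \<in> S" for r k w s
          using weak_normal_product_sylow_action[OF fin wnp ssB Nn _ comm_N syl p S(1-3) that] by (auto simp: N_def)
      qed (use K S in auto)
      then show ?thesis using S(1) subgroup.subset by blast
    next
      case 2
      then obtain x where x: "x \<in> A" "x \<notin> K" by blast
      have xc: "x \<in> carrier G" using x Ac by blast
      have "g \<otimes> x \<otimes> inv g \<in> K #> x [^] (1::nat)" if g: "g \<in> carrier G" for g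
      proof -
        have "g \<otimes> x \<otimes> inv g = (g \<otimes> x \<otimes> inv g \<otimes> inv x) \<otimes> x" using g xc by (simp add: m_assoc)
        moreover have "g \<otimes> x \<otimes> inv g \<otimes> inv x \<in> K" using comm_N[OF g x(1)] 2 by blast
        ultimately show ?thesis using xc by (auto simp: r_coset_def)
      qed
      then show ?thesis using x xc by blast
    next
      case 3
      let ?B = "G\<lparr>carrier := B\<rparr>"
      interpret Bg: group ?B using B by (rule subgroup_imp_group)
      have finB: "finite (carrier ?B)" using Bc fin by (simp add: finite_subset)
      obtain T l where T: "T 0 = {\<one>\<^bsub>?B\<^esub>}" "T l = carrier ?B" "\<And>i. i \<le> l \<Longrightarrow> T i \<lhd> ?B"
        and T_pow: "\<And>i g x. i < l \<Longrightarrow> g \<in> carrier ?B \<Longrightarrow> x \<in> T (Suc i) \<Longrightarrow>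
          \<exists>a::nat. g \<otimes>\<^bsub>?B\<^esub> x \<otimes>\<^bsub>?B\<^esub> inv\<^bsub>?B\<^esub> g \<in> T i #>\<^bsub>?B\<^esub> x [^]\<^bsub>?B\<^esub> a"
        using Bg.supersoluble_power_series[OF finB ssB] by metis
      have "\<not> B \<subseteq> K"
      proof
        assume "B \<subseteq> K"
        then have "carrier G \<subseteq> K" unfolding GAB using 3 subgroup.m_closed[OF Ksub] by (auto simp: set_mult_def)
        then show False using K Kc by blast
      qed
      then have "\<not> T l \<subseteq> K" using T(2) by simp
      moreover have "T 0 \<subseteq> K" using T(1) subgroup.one_closed[OF Ksub] by simp
      ultimately obtain i where i: "i < l" "T i \<subseteq> K" "\<not> T (Suc i) \<subseteq> K"
        using ex_least_nat_less[of "\<lambda>i. \<not> T i \<subseteq> K" l] by blast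
      then obtain x where x: "x \<in> T (Suc i)" "x \<notin> K" by blast
      have xB: "x \<in> B" using subgroup.subset[OF normal_imp_subgroup[OF T(3)[of "Suc i"]]] i(1) x(1) by auto
      have xc: "x \<in> carrier G" using xB Bc by blast
      have "\<exists>k::nat. g \<otimes> x \<otimes> inv g \<in> K #> x [^] k" if g: "g \<in> carrier G" for g
      proof -
        obtain a b where ab: "a \<in> A" "b \<in> B" "g = a \<otimes> b" using g unfolding GAB by (auto simp: set_mult_def)
        have c: "a \<in> carrier G" "b \<in> carrier G" using ab Ac Bc by auto
        obtain k :: nat where "b \<otimes> x \<otimes> inv b \<in> T i #> x [^] k"
          using T_pow[OF i(1), of b x] ab(2) x(1) B xB by (auto simp flip: nat_pow_consistent)
        then obtain z where z: "z \<in> K" "b \<otimes> x \<otimes> inv b = z \<otimes> x [^] k" using i(2) by (auto simp: r_coset_def)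
        have zc: "z \<in> carrier G" using z Kc by blast
        define y where "y = b \<otimes> x \<otimes> inv b"
        have yc: "y \<in> carrier G" using c xc by (simp add: y_def)
        have "y \<otimes> inv a \<otimes> inv y \<in> A" using conj_A[OF yc] ab(1) A(1) by (simp add: subgroup.m_inv_closed)
        then have q: "a \<otimes> (y \<otimes> inv a \<otimes> inv y) \<in> K" using 3 ab(1) A(1) by (meson subgroup.m_closed subsetD)
        have "g \<otimes> x \<otimes> inv g = a \<otimes> y \<otimes> inv a" unfolding ab(3) y_def using conj_conj c xc by simp
        also have "\<dots> = (a \<otimes> (y \<otimes> inv a \<otimes> inv y)) \<otimes> y" using c yc by (simp add: m_assoc)
        also have "\<dots> = (a \<otimes> (y \<otimes> inv a \<otimes> inv y)) \<otimes> z \<otimes> x [^] k"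
          using z(2) c yc zc xc by (simp add: y_def[symmetric] m_assoc)
        finally have "g \<otimes> x \<otimes> inv g \<in> K #> x [^] k"
          using subgroup.m_closed[OF Ksub q z(1)] by (auto simp: r_coset_def)
        then show ?thesis by blast
      qed
      then show ?thesis using x xc by blast
    qed
  qed
qed

theorem theoremC:
  fixes G :: "('a, 'b) monoid_scheme" and A B :: "'a set"
  assumes "group G"
    and "finite (carrier G)"
    and "weak_normal_product G A B"
    and "nilpotent_group (G\<lparr>carrier := derived G (carrier G)\<rparr>)"
    and "supersoluble_group (G\<lparr>carrier := A\<rparr>)"
    and "supersoluble_group (G\<lparr>carrier := B\<rparr>)"
  shows "supersoluble_group G"
  using assms by (rule group.weak_normal_product_supersoluble)

end
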